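(* Let $N\ge 1$ be an integer and $s\in(0,1)$. Let $h:\mathbb{R}\to\mathbb{R}$ and $f:[0,+\infty)\to\mathbb{R}$ satisfy: (1) $h$ is locally Hölder continuous in $\mathbb{R}$ with some exponent $\alpha\in(0,1)$; (2) $h$ is nondecreasing in $\mathbb{R}$, $h(0)=0$ and $h(t)>0$ for $t>0$; (3) $\lim_{t\to+\infty}h(t)=+\infty$; (4) $f$ is locally Lipschitz and nondecreasing in $[0,+\infty)$, with $f(0)=0$ and $f>0$ in $(0,+\infty)$; (5) $\displaystyle\lim_{r,t\to 0}\frac{f(r)-f(t)}{r-t}=0$ (limit over $r,t\ge 0$, $r\neq t$). Then the equation $$(-\Delta)^s u=h(x_N)f(u)\quad\text{in }\mathbb{R}^N$$ does not admit any positive, bounded classical solution $u$.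
   Context: Points of $\mathbb{R}^N$ are written $x=(x',x_N)$ with $x'\in\mathbb{R}^{N-1}$, $x_N\in\mathbb{R}$. For $s\in(0,1)$ the fractional Laplacian is $$(-\Delta)^s u(x)=c(N,s)\int_{\mathbb{R}^N}\frac{u(x)-u(y)}{|x-y|^{N+2s}}\,dy,$$ the integral being understood in the principal value sense, where $c(N,s)>0$ is a normalization constant (its value is irrelevant). A classical solution is a function $u:\mathbb{R}^N\to\mathbb{R}$ which is locally of class $C^{2s+\beta}$ in $\mathbb{R}^N$ for some $\beta\in(0,1)$ and verifies the equation at every point of $\mathbb{R}^N$. Here $C^{\sigma}$ for non-integer $\sigma=k+\theta$ ($k$ a nonnegative integer, $0<\theta<1$) denotes the Hölder class $C^{k,\theta}$. Positive means $u>0$ in $\mathbb{R}^N$. *)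

theory Defs
  imports "HOL-Analysis.Analysis"
begin

definition locally_holder_on :: "'a::metric_space set \<Rightarrow> real \<Rightarrow> ('a \<Rightarrow> 'b::metric_space) \<Rightarrow> bool" where
  "locally_holder_on S \<alpha> g \<longleftrightarrow>
     (\<forall>x\<in>S. \<exists>r>0. \<exists>C. \<forall>y\<in>cball x r \<inter> S. \<forall>z\<in>cball x r \<inter> S.
        dist (g y) (g z) \<le> C * dist y z powr \<alpha>)"

definition locally_lipschitz_on :: "'a::metric_space set \<Rightarrow> ('a \<Rightarrow> 'b::metric_space) \<Rightarrow> bool" where
  "locally_lipschitz_on S g \<longleftrightarrow> (\<forall>x\<in>S. \<exists>r>0. \<exists>L. L-lipschitz_on (cball x r \<inter> S) g)"

definition partial_deriv :: "'n::finite \<Rightarrow> (real ^ 'n \<Rightarrow> real) \<Rightarrow> real ^ 'n \<Rightarrow> real" where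
  "partial_deriv i u x = frechet_derivative u (at x) (axis i 1)"

text \<open>The local class \<open>C\<^sup>k\<^sup>,\<^sup>\<theta>\<close> on the whole space.  Continuity of the derivatives
  of order at most \<open>k\<close> need not be required separately: those of order less than \<open>k\<close> are
  differentiable, and those of order \<open>k\<close> are locally Hoelder continuous.\<close>

primrec locally_C_holder :: "nat \<Rightarrow> real \<Rightarrow> (real ^ 'n::finite \<Rightarrow> real) \<Rightarrow> bool" where
  "locally_C_holder 0 \<theta> u \<longleftrightarrow> locally_holder_on UNIV \<theta> u"
| "locally_C_holder (Suc k) \<theta> u \<longleftrightarrow>
     u differentiable_on UNIV \<and> (\<forall>i. locally_C_holder k \<theta> (partial_deriv i u))"

text \<open>The local class \<open>C\<^sup>\<sigma>\<close>, for non-integer \<open>\<sigma>\<close> only.\<close>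

definition locally_C :: "real \<Rightarrow> (real ^ 'n::finite \<Rightarrow> real) \<Rightarrow> bool" where
  "locally_C \<sigma> u \<longleftrightarrow>
     (\<exists>k \<theta>. 0 < \<theta> \<and> \<theta> < 1 \<and> \<sigma> = real k + \<theta> \<and> locally_C_holder k \<theta> u)"

definition frac_kernel_diff :: "real \<Rightarrow> (real ^ 'n::finite \<Rightarrow> real) \<Rightarrow> real ^ 'n \<Rightarrow> real ^ 'n \<Rightarrow> real" where
  "frac_kernel_diff s u x y = (u x - u y) / norm (x - y) powr (real CARD('n) + 2 * s)"

text \<open>\<open>has_frac_laplacian c s u x l\<close>: the principal value integral defining the fractional
  Laplacian of order \<open>s\<close> at \<open>x\<close>, with normalization constant \<open>c\<close>, exists and gives the value
  \<open>l\<close>.  Integrability off each ball is demanded because the Bochner integral of a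
  non-integrable function is \<open>0\<close>.\<close>

definition has_frac_laplacian ::
    "real \<Rightarrow> real \<Rightarrow> (real ^ 'n::finite \<Rightarrow> real) \<Rightarrow> real ^ 'n \<Rightarrow> real \<Rightarrow> bool" where
  "has_frac_laplacian c s u x l \<longleftrightarrow>
     (\<forall>\<epsilon>>0. set_integrable lborel (- ball x \<epsilon>) (frac_kernel_diff s u x)) \<and>
     ((\<lambda>\<epsilon>. c * (LINT y:(- ball x \<epsilon>)|lborel. frac_kernel_diff s u x y)) \<longlongrightarrow> l) (at_right 0)"

text \<open>Classical solutions of \<open>(-\<Delta>)\<^sup>s u = F(x, u)\<close> in the whole space.\<close>

definition classical_solution ::
    "real \<Rightarrow> real \<Rightarrow> (real ^ 'n::finite \<Rightarrow> real \<Rightarrow> real) \<Rightarrow> (real ^ 'n \<Rightarrow> real) \<Rightarrow> bool" where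
  "classical_solution c s F u \<longleftrightarrow>
     (\<exists>\<beta>. 0 < \<beta> \<and> \<beta> < 1 \<and> locally_C (2 * s + \<beta>) u) \<and>
     (\<forall>x. has_frac_laplacian c s u x (F x (u x)))"

end

theory Submission imports Defs begin

text \<open>
  Moving planes, carried out with pointwise comparison only. Write \<open>w(x) = u(x\<^sup>\<lambda>) - u(x)\<close>
  for the reflection \<open>x\<^sup>\<lambda>\<close> in \<open>x\<^sub>N = \<lambda>\<close>. Since \<open>h\<close> is nondecreasing, \<open>w\<close> satisfies
  \<open>(-\<Delta>)\<^sup>s w \<ge> h(x\<^sub>N) (f(u(x\<^sup>\<lambda>)) - f(u(x)))\<close>, and near a negative infimum \<open>-m\<close> of \<open>w\<close> over
  \<open>x\<^sub>N \<le> \<lambda>\<close>, at depth \<open>d\<close> below the plane, antisymmetry gives \<open>(-\<Delta>)\<^sup>s w \<le> - C m d\<^sup>-\<^sup>2\<^sup>s\<close> there.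
  This is impossible where \<open>h \<le> 0\<close>, hence \<open>w \<ge> 0\<close> for \<open>\<lambda> \<le> 0\<close>. If \<open>w \<ge> 0\<close> for some \<open>\<lambda> \<ge> 0\<close>
  but not for slightly larger \<open>\<lambda>'\<close>, the near-minimum lies in \<open>0 < x\<^sub>N < \<lambda>'\<close>, at depth bounded
  below (\<open>f\<close> is Lipschitz), at a point where \<open>u\<close> is bounded below (\<open>f'(0) = 0\<close>). That lower bound
  spreads, in terms of mass, to a ball beyond the plane; there \<open>h(x\<^sub>N) f(u)\<close> is bounded below, so
  \<open>w\<close> is bounded below on the mirror ball and then near the point itself. On averages \<open>w\<close> depends
  continuously on \<open>\<lambda>\<close>, whereas the equation at the near-minimum forces a negative average of order
  \<open>-m\<close>. Working with averages replaces all compactness and regularity theory. So \<open>u\<close> is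
  nondecreasing in \<open>x\<^sub>N\<close>, stays bounded below on unit balls moving to \<open>x\<^sub>N = \<infinity>\<close>, and there
  \<open>h(x\<^sub>N) f(u) \<rightarrow> \<infinity>\<close> contradicts the boundedness of \<open>u\<close>.
\<close>

section \<open>Integrals of the kernel\<close>

lemma sets_borel_ball [measurable]: "ball x r \<in> sets borel"
  by (rule borel_open) simp

text \<open>One substitution rule for dilations (scaling of the kernel integrals), for translations,
  and for the point reflection \<open>c = -1\<close>, under which odd terms integrate to
  zero.\<close>

lemma lborel_affine_integral:
  fixes f :: "'a::euclidean_space \<Rightarrow> real"
  assumes [measurable]: "f \<in> borel_measurable borel" and c: "c \<noteq> 0"
  shows lborel_affine_integrable_iff:
      "integrable lborel (\<lambda>x. f (t + c *\<^sub>R x)) \<longleftrightarrow> integrable lborel f"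
    and lborel_affine_integral_eq:
      "integral\<^sup>L lborel f = \<bar>c\<bar> ^ DIM('a) * (LINT x|lborel. f (t + c *\<^sub>R x))"
proof -
  have *: "lborel = density (distr lborel borel (\<lambda>x. t + c *\<^sub>R x)) (\<lambda>_. ennreal (\<bar>c\<bar> ^ DIM('a)))"
    using lborel_affine[OF c, of t] by (simp add: ennreal_power)
  have "integrable lborel f \<longleftrightarrow>
      integrable (density (distr lborel borel (\<lambda>x. t + c *\<^sub>R x)) (\<lambda>_. ennreal (\<bar>c\<bar> ^ DIM('a)))) f"
    using * by simp
  also have "\<dots> \<longleftrightarrow> integrable lborel (\<lambda>x. f (t + c *\<^sub>R x))"
    using c by (subst integrable_density) (auto simp: integrable_distr_eq)
  finally show "integrable lborel (\<lambda>x. f (t + c *\<^sub>R x)) \<longleftrightarrow> integrable lborel f" ..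
  have "integral\<^sup>L lborel f =
      integral\<^sup>L (density (distr lborel borel (\<lambda>x. t + c *\<^sub>R x)) (\<lambda>_. ennreal (\<bar>c\<bar> ^ DIM('a)))) f"
    using * by simp
  also have "\<dots> = \<bar>c\<bar> ^ DIM('a) * (LINT x|lborel. f (t + c *\<^sub>R x))"
    by (subst integral_density) (auto simp: integral_distr)
  finally show "integral\<^sup>L lborel f = \<bar>c\<bar> ^ DIM('a) * (LINT x|lborel. f (t + c *\<^sub>R x))" .
qed

lemma integrable_indicator_bounded:
  fixes w :: "'a::euclidean_space \<Rightarrow> real"
  assumes [measurable]: "w \<in> borel_measurable borel" "A \<in> sets borel"
    and "bounded A" and W: "\<And>y. \<bar>w y\<bar> \<le> W"
  shows "integrable lborel (\<lambda>y. indicator A y * w y)"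
proof (rule Bochner_Integration.integrable_bound[OF integrable_mult_left[OF integrable_real_indicator[of A lborel]]])
  show "emeasure lborel A < \<infinity>" using assms by (intro emeasure_bounded_finite)
  show "AE y in lborel. norm (indicator A y * w y) \<le> norm (indicator A y * W)"
    using W by (intro AE_I2) (auto simp: indicator_def intro: order_trans[OF _ abs_ge_self])
qed measurable

text \<open>The function lies below the series of \<open>c j\<close> times indicators of balls, and
  monotone convergence turns the integral of that series into a series of volumes. This replaces
  polar coordinates in the dyadic estimates of the kernel.\<close>

lemma integrable_dominated_by_balls:
  fixes g :: "'a::euclidean_space \<Rightarrow> real" and R c :: "nat \<Rightarrow> real"
  assumes g[measurable]: "g \<in> borel_measurable borel" and g0: "\<And>z. 0 \<le> g z"
    and dom: "\<And>z. g z \<noteq> 0 \<Longrightarrow> \<exists>j. z \<in> ball 0 (R j) \<and> g z \<le> c j"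
    and c: "\<And>j. 0 \<le> c j" and R: "\<And>j. 0 \<le> R j"
    and sum: "summable (\<lambda>j. c j * R j ^ DIM('a))"
  shows "integrable lborel g"
proof (rule integrableI_nonneg)
  let ?V = "unit_ball_vol (DIM('a))"
  have "(\<integral>\<^sup>+z. ennreal (g z) \<partial>lborel) \<le>
      (\<integral>\<^sup>+(z::'a). (\<Sum>j. ennreal (c j) * indicator (ball 0 (R j)) z) \<partial>lborel)"
  proof (rule nn_integral_mono)
    fix z :: 'a
    show "ennreal (g z) \<le> (\<Sum>j. ennreal (c j) * indicator (ball 0 (R j)) z)"
    proof (cases "g z = 0")
      case False
      then obtain j where j: "z \<in> ball 0 (R j)" "g z \<le> c j" using dom by blast
      have "ennreal (g z) \<le> (\<Sum>i\<in>{j}. ennreal (c i) * indicator (ball 0 (R i)) z)"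
        using j by (simp add: ennreal_leI)
      also have "\<dots> \<le> (\<Sum>i. ennreal (c i) * indicator (ball 0 (R i)) z)"
        by (rule sum_le_suminf) auto
      finally show ?thesis .
    qed simp
  qed
  also have "\<dots> = (\<Sum>j. \<integral>\<^sup>+(z::'a). ennreal (c j) * indicator (ball 0 (R j)) z \<partial>lborel)"
    by (rule nn_integral_suminf) measurable
  also have "\<dots> = (\<Sum>j. ennreal (?V * (c j * R j ^ DIM('a))))"
    using c R by (simp add: nn_integral_cmult_indicator emeasure_ball ennreal_mult' [symmetric] mult_ac)
  also have "\<dots> < \<infinity>"
    using c R sum by (subst suminf_ennreal2) (auto intro!: summable_mult)
  finally show "(\<integral>\<^sup>+z. ennreal (g z) \<partial>lborel) < \<infinity>" .
qed (use g0 in auto)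

section \<open>Quadratic expansions and penalised minima\<close>

lemma inner_diff_scaleR_self:
  fixes a e :: "'a::real_inner"
  shows "inner (a - t *\<^sub>R e) (a - t *\<^sub>R e) = inner a a - 2 * t * inner a e + t\<^sup>2 * inner e e"
  by (simp add: inner_diff_left inner_diff_right inner_commute[of e a] power2_eq_square algebra_simps)

text \<open>A penalty centred at \<open>x0\<close> is recentred at the minimum point
  \<open>x\<close>, at the price of a linear term. That term is odd about \<open>x\<close> and
  disappears from principal value integrals.\<close>

lemma quadratic_recentre:
  fixes x x0 y :: "'a::real_inner"
  assumes "v x + a * (norm (x - x0))\<^sup>2 \<le> v y + a * (norm (y - x0))\<^sup>2"
  shows "v x - v y \<le> a * ((norm (x - y))\<^sup>2 + 2 * inner (y - x) (x - x0))"
proof -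
  have "(norm (y - x0))\<^sup>2 - (norm (x - x0))\<^sup>2 = (norm (x - y))\<^sup>2 + 2 * inner (y - x) (x - x0)"
    by (simp add: power2_norm_eq_inner inner_simps inner_commute)
  then have "a * (norm (y - x0))\<^sup>2 - a * (norm (x - x0))\<^sup>2 = a * ((norm (x - y))\<^sup>2 + 2 * inner (y - x) (x - x0))"
    by (simp flip: right_diff_distrib)
  then show ?thesis using assms by linarith
qed

text \<open>The infimum of \<open>v\<close> over \<open>X\<close> need not be attained. Adding a
  parabola that reaches height \<open>b\<close> at distance \<open>r\<close> from \<open>x0\<close>
  forces a minimum inside the ball, because \<open>v x0\<close> is within \<open>b\<close> of the
  lower bound \<open>- m\<close>.\<close>

lemma perturbed_min:
  fixes v :: "'a::euclidean_space \<Rightarrow> real"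
  assumes X: "closed X" "x0 \<in> X" and v: "continuous_on UNIV v" and m: "\<And>y. y \<in> X \<Longrightarrow> - m \<le> v y"
    and b: "v x0 < - m + b" and r: "0 < r"
  obtains x where "x \<in> X" "x \<in> ball x0 r" "v x \<le> v x0"
    "\<And>y. y \<in> X \<Longrightarrow> v x - v y \<le> b / r\<^sup>2 * ((norm (x - y))\<^sup>2 + 2 * inner (y - x) (x - x0))"
proof -
  define a where "a = b / r\<^sup>2"
  have b0: "0 < b" using b m[OF X(2)] by linarith
  have a: "0 < a" "a * r\<^sup>2 = b" using b0 r by (simp_all add: a_def)
  let ?g = "\<lambda>y. v y + a * (norm (y - x0))\<^sup>2"
  have "compact (X \<inter> cball x0 r)" using X by (intro closed_Int_compact) auto
  moreover have "x0 \<in> X \<inter> cball x0 r" using X r by simp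
  moreover have "continuous_on (X \<inter> cball x0 r) ?g"
    by (intro continuous_intros continuous_on_subset[OF v]) auto
  ultimately obtain x where x: "x \<in> X \<inter> cball x0 r" and min: "\<And>y. y \<in> X \<inter> cball x0 r \<Longrightarrow> ?g x \<le> ?g y"
    using continuous_attains_inf[of "X \<inter> cball x0 r" ?g] by blast
  have gx: "?g x \<le> v x0" using min[of x0] X r by simp
  have all: "?g x \<le> ?g y" if "y \<in> X" for y
  proof (cases "y \<in> cball x0 r")
    case False
    then have "r\<^sup>2 \<le> (norm (y - x0))\<^sup>2"
      using r by (intro power_mono) (auto simp: dist_norm norm_minus_commute)
    then have "b \<le> a * (norm (y - x0))\<^sup>2" using a(1) mult_left_mono[of "r\<^sup>2" "(norm (y - x0))\<^sup>2" a] unfolding a(2) by simp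
    then show ?thesis using gx m[OF that] b by linarith
  next
    case True
    then show ?thesis using that by (intro min) simp
  qed
  have "- m \<le> v x" using x by (intro m) simp
  then have "a * (norm (x - x0))\<^sup>2 < a * r\<^sup>2" using gx b a(2) by linarith
  then have "(norm (x - x0))\<^sup>2 < r\<^sup>2" using a(1) by simp
  then have "norm (x - x0) < r" using power_less_imp_less_base[of "norm (x - x0)" 2 r] r by simp
  then have "x \<in> ball x0 r" by (simp add: dist_norm norm_minus_commute)
  moreover have "v x \<le> v x0" using gx mult_nonneg_nonneg[of a "(norm (x - x0))\<^sup>2"] a(1)
    by (smt (verit) zero_le_power2)
  moreover have "v x - v y \<le> b / r\<^sup>2 * ((norm (x - y))\<^sup>2 + 2 * inner (y - x) (x - x0))" if "y \<in> X" for y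
    using quadratic_recentre[of v x a x0 y, OF all[OF that]] by (simp add: a_def)
  ultimately show ?thesis
    using x by (intro that[of x]) simp_all
qed

section \<open>The kernel of the fractional Laplacian\<close>

locale frac_kernel =
  fixes s :: real and k :: "'n::finite"
  assumes s0: "0 < s" and s1: "s < 1"
begin

definition kexp :: real where "kexp = real CARD('n) + 2 * s"

text \<open>At the origin division by zero gives the value \<open>0\<close>, not infinity; hence the
  lower bound \<open>K_ge\<close> requires \<open>z \<noteq> 0\<close>.\<close>

definition K :: "real ^ 'n \<Rightarrow> real" where "K z = 1 / norm z powr kexp"

lemma kexp_pos: "0 < kexp" and kexp_ge1: "1 \<le> kexp"
proof -
  have "0 < CARD('n)" by (rule zero_less_card_finite)
  then have "1 \<le> real CARD('n)" by linarith
  then show "0 < kexp" "1 \<le> kexp" using s0 unfolding kexp_def by linarith+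
qed

lemma K_nonneg [simp]: "0 \<le> K z" by (simp add: K_def)

lemma K_minus_commute: "K (x - y) = K (y - x)" by (simp add: K_def norm_minus_commute)

lemma K_measurable [measurable]: "K \<in> borel_measurable borel"
  unfolding K_def by measurable

lemma K_antimono: "0 < norm z \<Longrightarrow> norm z \<le> norm z' \<Longrightarrow> K z' \<le> K z"
  unfolding K_def using kexp_pos by (intro divide_left_mono powr_mono2 mult_pos_pos) (auto simp: powr_gt_zero)

lemma K_le: "0 < r \<Longrightarrow> r \<le> norm z \<Longrightarrow> K z \<le> r powr (- kexp)"
  unfolding K_def powr_minus_divide using kexp_pos by (intro divide_left_mono powr_mono2 mult_pos_pos) (auto simp: powr_gt_zero)

lemma K_ge: "z \<noteq> 0 \<Longrightarrow> norm z \<le> r \<Longrightarrow> r powr (- kexp) \<le> K z"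
  unfolding K_def powr_minus_divide using kexp_pos by (intro divide_left_mono powr_mono2 mult_pos_pos) (auto simp: powr_gt_zero)

lemma K_scale: "0 < r \<Longrightarrow> K (r *\<^sub>R z) = r powr (- kexp) * K z"
  by (simp add: K_def powr_mult powr_minus_divide)

definition unit_vol :: real where "unit_vol = unit_ball_vol (real CARD('n))"

lemma unit_vol_pos: "0 < unit_vol" by (simp add: unit_vol_def)

lemma content_ball_unit_vol: "0 \<le> r \<Longrightarrow> measure lborel (ball (x::real^'n) r) = unit_vol * r ^ CARD('n)"
  using content_ball[of r x] by (simp add: unit_vol_def)

lemma card_powr: "0 < r \<Longrightarrow> r ^ CARD('n) * r powr (- kexp) = r powr (- 2 * s)"
  by (simp add: powr_realpow[symmetric] powr_add[symmetric] kexp_def)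

section \<open>Tail mass and second moment of the kernel\<close>

definition tail_const :: real where "tail_const = (LINT z|lborel. indicator (- ball 0 1) z * K z)"
definition core_const :: real where "core_const = (LINT z|lborel. indicator (ball 0 1) z * ((norm z)\<^sup>2 * K z))"

lemma tail_const_nonneg: "0 \<le> tail_const" and core_const_nonneg: "0 \<le> core_const"
  unfolding tail_const_def core_const_def by (auto intro!: integral_nonneg)

lemma two_powr_floor:
  fixes t :: real assumes "1 \<le> t"
  obtains j :: nat where "2 powr real j \<le> t" "t < 2 powr real (Suc j)"
proof
  let ?j = "nat \<lfloor>log 2 t\<rfloor>"
  have l: "0 \<le> log 2 t" using assms by simp
  then have "real ?j \<le> log 2 t" "log 2 t < real (Suc ?j)" by linarith+
  then show "2 powr real ?j \<le> t" "t < 2 powr real (Suc ?j)"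
    using assms by (simp_all only: le_log_iff log_less_iff)
qed

lemma summable_two_powr: assumes "0 < a" shows "summable (\<lambda>j. 2 powr (- (a * real j)))"
proof -
  have "(\<lambda>j. 2 powr (- (a * real j))) = (\<lambda>j. (2 powr (- a)) ^ j)"
    by (auto simp: powr_realpow[symmetric] powr_powr)
  moreover have "(2::real) powr (- a) < 1" using assms powr_less_mono[of "-a" 0 2] by simp
  ultimately show ?thesis by (simp add: summable_geometric)
qed

text \<open>Over dyadic shells going outwards, kernel size times volume decays geometrically with
  ratio \<open>2 powr (- 2 * s)\<close>; this uses \<open>0 < s\<close>.\<close>

lemma tail_integrable1: "integrable lborel (\<lambda>z. indicator (- ball 0 1) z * K z)"
proof (rule integrable_dominated_by_balls
    [where R = "\<lambda>j. 2 powr real (Suc j)" and c = "\<lambda>j. 2 powr (- (real j * kexp))"])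
  fix z :: "real ^ 'n" assume "indicator (- ball 0 1) z * K z \<noteq> 0"
  then have z: "1 \<le> norm z" by (auto simp: indicator_def split: if_splits)
  then obtain j :: nat where j: "2 powr real j \<le> norm z" "norm z < 2 powr real (Suc j)"
    by (rule two_powr_floor)
  have "K z \<le> (2 powr real j) powr (- kexp)" using j by (intro K_le) auto
  then have "K z \<le> 2 powr (- (real j * kexp))" by (simp add: powr_powr)
  with j z show "\<exists>j. z \<in> ball 0 (2 powr real (Suc j)) \<and>
      indicator (- ball 0 1) z * K z \<le> 2 powr (- (real j * kexp))"
    by (intro exI[of _ j]) (simp add: indicator_def)
next
  have "(\<lambda>j. 2 powr (- (real j * kexp)) * (2 powr real (Suc j)) ^ DIM(real^'n)) =
      (\<lambda>j. 2 ^ CARD('n) * 2 powr (- (2 * s * real j)))"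
    by (rule ext) (simp add: powr_realpow[symmetric] powr_powr powr_add[symmetric] kexp_def algebra_simps)
  then show "summable (\<lambda>j. 2 powr (- (real j * kexp)) * (2 powr real (Suc j)) ^ DIM(real^'n))"
    using s0 by (auto intro!: summable_mult summable_two_powr)
next
  show "(\<lambda>z. indicator (- ball 0 1) z * K z) \<in> borel_measurable borel" by measurable
qed auto

text \<open>Over dyadic shells shrinking to the origin, the squared norm leaves the geometric ratio
  \<open>2 powr (- (2 - 2 * s))\<close>; this uses \<open>s < 1\<close>.\<close>

lemma core_integrable1: "integrable lborel (\<lambda>z. indicator (ball 0 1) z * ((norm z)\<^sup>2 * K z))"
\<comment> \<open>The radius is twice that of the shell: the bound
  \<open>norm z \<le> 2 powr (- real j)\<close> is not strict, while the balls are open.\<close>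
proof (rule integrable_dominated_by_balls
    [where R = "\<lambda>j. 2 powr (1 - real j)" and c = "\<lambda>j. 2 powr (2 - 2 * real j + (real (Suc j)) * kexp)"])
  fix z :: "real ^ 'n" assume "indicator (ball 0 1) z * ((norm z)\<^sup>2 * K z) \<noteq> 0"
  then have z: "norm z < 1" "z \<noteq> 0" by (auto simp: indicator_def split: if_splits)
  then have "1 \<le> 1 / norm z" by simp
  then obtain j :: nat where j: "2 powr real j \<le> 1 / norm z" "1 / norm z < 2 powr real (Suc j)"
    by (rule two_powr_floor)
  have n1: "norm z \<le> 2 powr (- real j)" and n2: "2 powr (- real (Suc j)) \<le> norm z"
    using j z by (simp_all only: powr_minus_divide) (auto simp: field_simps)
  have "K z \<le> (2 powr (- real (Suc j))) powr (- kexp)" using n2 by (intro K_le) auto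
  also have "\<dots> = 2 powr (real (Suc j) * kexp)" by (simp add: powr_powr algebra_simps)
  finally have "(norm z)\<^sup>2 * K z \<le> (2 powr (1 - real j))\<^sup>2 * 2 powr (real (Suc j) * kexp)"
    using n1 order_trans[OF n1, of "2 powr (1 - real j)"] by (intro mult_mono power_mono) auto
  also have "\<dots> = 2 powr (2 - 2 * real j + (real (Suc j)) * kexp)"
    by (simp add: power2_eq_square powr_add[symmetric] algebra_simps)
  finally show "\<exists>j. z \<in> ball 0 (2 powr (1 - real j)) \<and>
      indicator (ball 0 1) z * ((norm z)\<^sup>2 * K z) \<le> 2 powr (2 - 2 * real j + (real (Suc j)) * kexp)"
    using z n1 by (intro exI[of _ j]) (auto intro: le_less_trans)
next
  have "(\<lambda>j. 2 powr (2 - 2 * real j + (real (Suc j)) * kexp) * (2 powr (1 - real j)) ^ DIM(real^'n)) =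
      (\<lambda>j. 2 powr (2 + kexp + CARD('n)) * 2 powr (- ((2 - 2 * s) * real j)))"
    by (rule ext) (simp add: powr_realpow[symmetric] powr_powr powr_add[symmetric] kexp_def algebra_simps)
  then show "summable (\<lambda>j. 2 powr (2 - 2 * real j + (real (Suc j)) * kexp) * (2 powr (1 - real j)) ^ DIM(real^'n))"
    using s1 by (auto intro!: summable_mult summable_two_powr)
next
  show "(\<lambda>z. indicator (ball 0 1) z * ((norm z)\<^sup>2 * K z)) \<in> borel_measurable borel" by measurable
qed auto

lemma tail_scale:
  assumes r: "0 < r"
  shows tail_integrable: "integrable lborel (\<lambda>z. indicator (- ball 0 r) z * K z)"
    and tail_integral: "(LINT z|lborel. indicator (- ball 0 r) z * K z) = tail_const * r powr (- 2 * s)"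
proof -
  let ?f = "\<lambda>z. indicator (- ball 0 r) z * K z"
  have *: "?f (0 + r *\<^sub>R z) = r powr (- kexp) * (indicator (- ball 0 1) z * K z)" for z
    using r by (auto simp: K_scale indicator_def)
  have m: "?f \<in> borel_measurable borel" by measurable
  show "integrable lborel ?f"
    using lborel_affine_integrable_iff[OF m, of r 0] r tail_integrable1 unfolding * by simp
  show "integral\<^sup>L lborel ?f = tail_const * r powr (- 2 * s)"
    using lborel_affine_integral_eq[OF m, of r 0] r card_powr[OF r] unfolding * tail_const_def by simp
qed

lemma core_scale:
  assumes r: "0 < r"
  shows core_integrable: "integrable lborel (\<lambda>z. indicator (ball 0 r) z * ((norm z)\<^sup>2 * K z))"
    and core_integral: "(LINT z|lborel. indicator (ball 0 r) z * ((norm z)\<^sup>2 * K z)) = core_const * (r\<^sup>2 * r powr (- 2 * s))"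
proof -
  let ?f = "\<lambda>z. indicator (ball 0 r) z * ((norm z)\<^sup>2 * K z)"
  have *: "?f (0 + r *\<^sub>R z) = (r\<^sup>2 * r powr (- kexp)) * (indicator (ball 0 1) z * ((norm z)\<^sup>2 * K z))" for z
    using r by (auto simp: K_scale indicator_def power_mult_distrib)
  have m: "?f \<in> borel_measurable borel" by measurable
  show "integrable lborel ?f"
    using lborel_affine_integrable_iff[OF m, of r 0] r core_integrable1 unfolding * by simp
  show "integral\<^sup>L lborel ?f = core_const * (r\<^sup>2 * r powr (- 2 * s))"
    using lborel_affine_integral_eq[OF m, of r 0] r card_powr[OF r] unfolding * core_const_def by simp
qed

lemma tail_at:
  assumes r: "0 < r"
  shows tail_at_integrable: "integrable lborel (\<lambda>y. indicator (- ball x r) y * K (x - y))"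
    and tail_at_integral: "(LINT y|lborel. indicator (- ball x r) y * K (x - y)) = tail_const * r powr (- 2 * s)"
proof -
  let ?f = "\<lambda>y. indicator (- ball x r) y * K (x - y)"
  have *: "?f (x + 1 *\<^sub>R z) = indicator (- ball 0 r) z * K z" for z
    by (auto simp: indicator_def dist_norm K_def)
  have m: "?f \<in> borel_measurable borel" by measurable
  show "integrable lborel ?f"
    using lborel_affine_integrable_iff[OF m, of 1 x] tail_integrable[OF r] unfolding * by simp
  show "integral\<^sup>L lborel ?f = tail_const * r powr (- 2 * s)"
    using lborel_affine_integral_eq[OF m, of 1 x] tail_integral[OF r] unfolding * by simp
qed

lemma core_at:
  assumes r: "0 < r"
  shows core_at_integrable: "integrable lborel (\<lambda>y. indicator (ball x r) y * ((norm (x - y))\<^sup>2 * K (x - y)))"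
    and core_at_integral: "(LINT y|lborel. indicator (ball x r) y * ((norm (x - y))\<^sup>2 * K (x - y)))
      = core_const * (r\<^sup>2 * r powr (- 2 * s))"
proof -
  let ?f = "\<lambda>y. indicator (ball x r) y * ((norm (x - y))\<^sup>2 * K (x - y))"
  have *: "?f (x + 1 *\<^sub>R z) = indicator (ball 0 r) z * ((norm z)\<^sup>2 * K z)" for z
    by (auto simp: indicator_def dist_norm K_def)
  have m: "?f \<in> borel_measurable borel" by measurable
  show "integrable lborel ?f"
    using lborel_affine_integrable_iff[OF m, of 1 x] core_integrable[OF r] unfolding * by simp
  show "integral\<^sup>L lborel ?f = core_const * (r\<^sup>2 * r powr (- 2 * s))"
    using lborel_affine_integral_eq[OF m, of 1 x] core_integral[OF r] unfolding * by simp
qed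


lemma integrable_ball_const:
  fixes x :: "real ^ 'n"
  assumes "0 \<le> r"
  shows "integrable lborel (\<lambda>y. indicator (ball x r) y * (\<kappa> :: real))"
    and "(LINT y|lborel. indicator (ball x r) y * \<kappa>) = unit_vol * r ^ CARD('n) * \<kappa>"
proof -
  have f: "emeasure lborel (ball x r) < \<infinity>" using emeasure_lborel_ball_finite by auto
  then show "integrable lborel (\<lambda>y. indicator (ball x r) y * \<kappa>)"
    by (intro integrable_mult_left integrable_real_indicator) auto
  show "(LINT y|lborel. indicator (ball x r) y * \<kappa>) = unit_vol * r ^ CARD('n) * \<kappa>"
    using f content_ball_unit_vol[OF assms, of x] by simp
qed

text \<open>The unit ball about \<open>2 *\<^sub>R axis k 1\<close> lies outside the open unit ball,
  and the kernel is at least \<open>3 powr (- kexp)\<close> on it. Later bounds divide by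
  \<open>tail_const\<close>.\<close>

lemma tail_const_pos: "0 < tail_const"
proof -
  define z :: "real ^ 'n" where "z = 2 *\<^sub>R axis k 1"
  have z: "norm y \<le> 3" "1 \<le> norm y" if "y \<in> ball z 1" for y
    using that norm_triangle_ineq2[of z y] norm_triangle_ineq[of "y - z" z]
    by (auto simp: z_def dist_norm norm_minus_commute)
  have "(LINT y|lborel. indicator (ball z 1) y * 3 powr (- kexp)) \<le> tail_const"
    unfolding tail_const_def
  proof (rule integral_mono)
    show "integrable lborel (\<lambda>y. indicator (ball z 1) y * 3 powr (- kexp))"
      by (rule integrable_ball_const) simp
    show "indicator (ball z 1) y * 3 powr (- kexp) \<le> indicator (- ball 0 1) y * K y" for y
    proof (cases "y \<in> ball z 1")
      case True
      then have "y \<noteq> 0" using z(2)[OF True] by auto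
      then show ?thesis using True z[OF True] K_ge[of y 3] by simp
    qed simp
  qed (rule tail_integrable1)
  then show ?thesis using unit_vol_pos integrable_ball_const(2)[of 1 z "3 powr (- kexp)"]
    by (smt (verit) mult_pos_pos powr_gt_zero power_one zero_le_one)
qed

text \<open>At distances up to \<open>D\<close>, an additive gap between squared distances becomes a
  factor \<open>\<mu> > 1\<close> between distances. The kernels then differ by a fixed fraction of
  the larger one, which is at least \<open>D powr (- kexp)\<close>.\<close>

lemma kernel_gap:
  assumes D: "0 < D" and \<kappa>: "0 < \<kappa>"
  obtains J0 where "0 < J0" "\<And>x y y'. x \<noteq> y \<Longrightarrow> norm (x - y) \<le> D \<Longrightarrow>
    (norm (x - y))\<^sup>2 + \<kappa> \<le> (norm (x - y'))\<^sup>2 \<Longrightarrow> J0 \<le> K (x - y) - K (x - y')"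
proof -
  define \<mu> where "\<mu> = sqrt (1 + \<kappa> / D\<^sup>2)"
  have \<mu>: "1 < \<mu>" using D \<kappa> by (simp add: \<mu>_def)
  then have \<mu>p: "\<mu> powr (- kexp) < 1" using powr_less_mono[of "- kexp" 0 \<mu>] kexp_pos by simp
  have "D powr (- kexp) * (1 - \<mu> powr (- kexp)) \<le> K (x - y) - K (x - y')"
    if "x \<noteq> y" "norm (x - y) \<le> D" "(norm (x - y))\<^sup>2 + \<kappa> \<le> (norm (x - y'))\<^sup>2" for x y y'
  proof -
    let ?n = "norm (x - y)"
    have "\<mu>\<^sup>2 = 1 + \<kappa> / D\<^sup>2" using \<kappa> by (simp add: \<mu>_def)
    then have "(\<mu> * ?n)\<^sup>2 = ?n\<^sup>2 + \<kappa> * (?n\<^sup>2 / D\<^sup>2)"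
      by (simp add: power_mult_distrib distrib_right)
    also have "\<dots> \<le> ?n\<^sup>2 + \<kappa> * 1"
      using that(2) D \<kappa> by (intro add_left_mono mult_left_mono) (auto simp: power_mono)
    also have "\<dots> \<le> (norm (x - y'))\<^sup>2" using that(3) by simp
    finally have "\<mu> * ?n \<le> norm (x - y')" by (rule power2_le_imp_le) simp
    then have "K (x - y') \<le> (\<mu> * ?n) powr (- kexp)" using that(1) \<mu> by (intro K_le) auto
    also have "\<dots> = \<mu> powr (- kexp) * ?n powr (- kexp)" using \<mu> by (simp add: powr_mult)
    finally have "?n powr (- kexp) * (1 - \<mu> powr (- kexp)) \<le> K (x - y) - K (x - y')"
      using K_ge[of "x - y" ?n] that(1) by (simp add: algebra_simps)
    moreover have "D powr (- kexp) * (1 - \<mu> powr (- kexp)) \<le> ?n powr (- kexp) * (1 - \<mu> powr (- kexp))"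
      using that kexp_pos \<mu>p by (intro mult_right_mono powr_mono2') auto
    ultimately show ?thesis by linarith
  qed
  then show ?thesis using D \<mu>p by (intro that[of "D powr (- kexp) * (1 - \<mu> powr (- kexp))"]) auto
qed

section \<open>Touching from below\<close>


lemma frac_kernel_diff_K: "frac_kernel_diff s u x y = (u x - u y) * K (x - y)"
  by (simp add: frac_kernel_diff_def K_def kexp_def)

lemma has_frac_laplacian_integrable:
  assumes "has_frac_laplacian c s u x l" "0 < \<epsilon>"
  shows "integrable lborel (\<lambda>y. indicator (- ball x \<epsilon>) y * ((u x - u y) * K (x - y)))"
  using assms unfolding has_frac_laplacian_def set_integrable_def frac_kernel_diff_K by simp

lemma has_frac_laplacian_tendsto:
  assumes "has_frac_laplacian c s u x l"
  shows "((\<lambda>\<epsilon>. c * (LINT y|lborel. indicator (- ball x \<epsilon>) y * ((u x - u y) * K (x - y)))) \<longlongrightarrow> l)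
    (at_right 0)"
  using assms unfolding has_frac_laplacian_def set_lebesgue_integral_def frac_kernel_diff_K by simp

lemma has_frac_laplacianI:
  assumes "\<And>\<epsilon>. 0 < \<epsilon> \<Longrightarrow> integrable lborel (\<lambda>y. indicator (- ball x \<epsilon>) y * ((u x - u y) * K (x - y)))"
    and "((\<lambda>\<epsilon>. c * (LINT y|lborel. indicator (- ball x \<epsilon>) y * ((u x - u y) * K (x - y)))) \<longlongrightarrow> l)
    (at_right 0)"
  shows "has_frac_laplacian c s u x l"
  using assms unfolding has_frac_laplacian_def set_lebesgue_integral_def set_integrable_def
    frac_kernel_diff_K by simp

text \<open>The error of order \<open>\<epsilon> ^ CARD('n)\<close> allows for mirror terms that
  stay unpaired when a ball of radius \<open>\<epsilon>\<close> is excised; it vanishes in the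
  limit.\<close>

lemma has_frac_laplacian_le:
  assumes l: "has_frac_laplacian c s u x l" and c: "0 \<le> c" and \<rho>: "0 < \<rho>"
    and le: "\<And>\<epsilon>. 0 < \<epsilon> \<Longrightarrow> \<epsilon> < \<rho> \<Longrightarrow>
      (LINT y|lborel. indicator (- ball x \<epsilon>) y * ((u x - u y) * K (x - y))) \<le> B + \<kappa> * \<epsilon> ^ CARD('n)"
  shows "l \<le> c * B"
proof (rule tendsto_le[OF _ _ has_frac_laplacian_tendsto[OF l]])
  have "((\<lambda>\<epsilon>. c * (B + \<kappa> * \<epsilon> ^ CARD('n))) \<longlongrightarrow> c * (B + \<kappa> * 0 ^ CARD('n))) (at_right 0)"
    by (intro tendsto_intros)
  then show "((\<lambda>\<epsilon>. c * (B + \<kappa> * \<epsilon> ^ CARD('n))) \<longlongrightarrow> c * B) (at_right 0)"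
    by (simp add: zero_power)
  show "\<forall>\<^sub>F \<epsilon> in at_right 0.
      c * (LINT y|lborel. indicator (- ball x \<epsilon>) y * ((u x - u y) * K (x - y)))
      \<le> c * (B + \<kappa> * \<epsilon> ^ CARD('n))"
    using \<rho> by (subst eventually_at_right[of 0 \<rho>]) (auto intro!: exI[of _ \<rho>] mult_left_mono le c)
qed simp

text \<open>The annulus and the kernel are symmetric about \<open>x\<close>, so the linear term
  integrates to zero. The quadratic term is bounded by the second moment, uniformly in
  \<open>\<epsilon>\<close>.\<close>

lemma annulus_quadratic:
  assumes \<epsilon>: "0 < \<epsilon>" and \<rho>: "0 < \<rho>" and a: "0 \<le> a"
  shows annulus_quadratic_integrable: "integrable lborel (\<lambda>y. indicator (ball x \<rho> - ball x \<epsilon>) y *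
      (a * ((norm (x - y))\<^sup>2 + 2 * inner (y - x) e) * K (x - y)))" (is ?I)
    and annulus_quadratic_integral: "(LINT y|lborel. indicator (ball x \<rho> - ball x \<epsilon>) y *
      (a * ((norm (x - y))\<^sup>2 + 2 * inner (y - x) e) * K (x - y))) \<le> a * core_const * (\<rho>\<^sup>2 * \<rho> powr (- 2 * s))" (is ?L)
proof -
  let ?A = "ball x \<rho> - ball x \<epsilon>"
  define q where "q y = indicator ?A y * ((norm (x - y))\<^sup>2 * K (x - y))" for y
  define od where "od y = indicator ?A y * (inner (y - x) e * K (x - y))" for y
  have [measurable]: "q \<in> borel_measurable borel" "od \<in> borel_measurable borel"
    unfolding q_def od_def by measurable
  have q: "integrable lborel q"
    by (rule Bochner_Integration.integrable_bound[OF core_at_integrable[OF \<rho>, of x]])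
      (auto simp: q_def indicator_def)
  have "integral\<^sup>L lborel q \<le> (LINT y|lborel. indicator (ball x \<rho>) y * ((norm (x - y))\<^sup>2 * K (x - y)))"
    by (rule integral_mono[OF q core_at_integrable[OF \<rho>]]) (auto simp: q_def indicator_def)
  then have ql: "integral\<^sup>L lborel q \<le> core_const * (\<rho>\<^sup>2 * \<rho> powr (- 2 * s))"
    using core_at_integral[OF \<rho>] by simp
  \<comment> \<open>The majorant depends on \<open>\<epsilon>\<close>, but integrability on each
    fixed annulus is all that splitting the integral requires.\<close>
  have od_int: "integrable lborel od"
  proof (rule Bochner_Integration.integrable_bound
      [OF integrable_mult_right[OF tail_at_integrable[OF \<epsilon>, of x], of "\<rho> * norm e"]])
    have "norm (od y) \<le> norm (\<rho> * norm e * (indicator (- ball x \<epsilon>) y * K (x - y)))" for y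
    proof (cases "y \<in> ?A")
      case True
      have "\<bar>inner (y - x) e\<bar> \<le> norm (y - x) * norm e" by (rule Cauchy_Schwarz_ineq2)
      also have "\<dots> \<le> \<rho> * norm e"
        using True by (intro mult_right_mono) (auto simp: dist_norm norm_minus_commute)
      finally have "\<bar>inner (y - x) e\<bar> * K (x - y) \<le> \<rho> * norm e * K (x - y)"
        by (rule mult_right_mono) simp
      then show ?thesis using True \<rho> by (simp add: od_def abs_mult)
    qed (simp add: od_def)
    then show "AE y in lborel. norm (od y) \<le> norm (\<rho> * norm e * (indicator (- ball x \<epsilon>) y * K (x - y)))"
      by simp
  qed measurable
  have "od ((2 *\<^sub>R x) + (-1) *\<^sub>R y) = - od y" for y
  proof -
    have "x - (2 *\<^sub>R x + (-1) *\<^sub>R y) = y - x" "(2 *\<^sub>R x + (-1) *\<^sub>R y) - x = - (y - x)"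
      by (simp_all add: algebra_simps scaleR_2)
    then show ?thesis
      by (simp only: od_def indicator_def Diff_iff mem_ball dist_norm norm_minus_commute[of x y]
          inner_minus_left K_minus_commute[of x y])
  qed
  then have "integral\<^sup>L lborel od = 0"
    using lborel_affine_integral_eq[of od "-1" "2 *\<^sub>R x"] by simp
  moreover have eq: "(\<lambda>y. indicator ?A y * (a * ((norm (x - y))\<^sup>2 + 2 * inner (y - x) e) * K (x - y)))
      = (\<lambda>y. a * q y + (2 * a) * od y)"
    by (rule ext) (simp add: q_def od_def distrib_left distrib_right mult_ac)
  ultimately show ?I ?L
    unfolding eq using q od_int mult_left_mono[OF ql a] by (simp_all add: mult.assoc)
qed

text \<open>The one-sided quadratic bound takes the place of regularity of \<open>v\<close> at
  \<open>x\<close>: it controls the part near the singularity uniformly in the excised radius, while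
  the part beyond \<open>\<rho>\<close> is kept exactly.\<close>

lemma touch_below:
  assumes c: "0 < c" and l: "has_frac_laplacian c s v x l" and \<rho>: "0 < \<rho>" and a: "0 \<le> a"
    and touch: "\<And>y. y \<in> ball x \<rho> \<Longrightarrow> v x - v y \<le> a * ((norm (x - y))\<^sup>2 + 2 * inner (y - x) e)"
  shows "l \<le> c * (a * core_const * (\<rho>\<^sup>2 * \<rho> powr (- 2 * s)) +
    (LINT y|lborel. indicator (- ball x \<rho>) y * ((v x - v y) * K (x - y))))"
proof (rule has_frac_laplacian_le[OF l _ \<rho>, where \<kappa> = 0])
  fix \<epsilon> :: real assume \<epsilon>: "0 < \<epsilon>" "\<epsilon> < \<rho>"
  let ?I = "\<lambda>\<rho> y. indicator (- ball x \<rho>) y * ((v x - v y) * K (x - y))"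
  let ?Q = "\<lambda>y. indicator (ball x \<rho> - ball x \<epsilon>) y *
      (a * ((norm (x - y))\<^sup>2 + 2 * inner (y - x) e) * K (x - y))"
  have I: "integrable lborel (?I \<rho>)" "integrable lborel (?I \<epsilon>)" "integrable lborel ?Q"
    using has_frac_laplacian_integrable[OF l] \<rho> \<epsilon> annulus_quadratic_integrable[OF \<epsilon>(1) \<rho> a] by auto
  have "integral\<^sup>L lborel (?I \<epsilon>) \<le> (LINT y|lborel. ?Q y + ?I \<rho> y)"
  proof (rule integral_mono)
    show "?I \<epsilon> y \<le> ?Q y + ?I \<rho> y" for y
      using mult_right_mono[OF touch[of y], of "K (x - y)"] \<epsilon> by (auto simp: indicator_def)
  qed (use I in auto)
  also have "\<dots> = integral\<^sup>L lborel ?Q + integral\<^sup>L lborel (?I \<rho>)"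
    using I by simp
  finally show "integral\<^sup>L lborel (?I \<epsilon>) \<le>
      a * core_const * (\<rho>\<^sup>2 * \<rho> powr (- 2 * s)) + integral\<^sup>L lborel (?I \<rho>) + 0 * \<epsilon> ^ CARD('n)"
    using annulus_quadratic_integral[OF \<epsilon>(1) \<rho> a, of x e] by simp
qed (use c in simp)

section \<open>Reflections and antisymmetric functions\<close>

definition reflect :: "real \<Rightarrow> real ^ 'n \<Rightarrow> real ^ 'n" where
  "reflect lam x = x + (2 * (lam - x $ k)) *\<^sub>R axis k 1"

lemma reflect_nth: "reflect lam x $ i = (if i = k then 2 * lam - x $ k else x $ i)"
  by (auto simp: reflect_def axis_def)

lemma reflect_reflect [simp]: "reflect lam (reflect lam x) = x"
  by (simp add: vec_eq_iff reflect_nth)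

lemma reflect_hyperplane: "x $ k = lam \<Longrightarrow> reflect lam x = x"
  by (simp add: reflect_def)

text \<open>The added term is nonnegative for two points on the same side of the plane, and it
  measures by how much the mirror kernel is smaller.\<close>

lemma norm_diff_refl_sq:
  "(norm (x - reflect lam y))\<^sup>2 = (norm (x - y))\<^sup>2 + 4 * (lam - x $ k) * (lam - y $ k)"
proof -
  define t where "t = 2 * (lam - y $ k)"
  have eq: "x - reflect lam y = (x - y) - t *\<^sub>R axis k 1" by (simp add: reflect_def t_def)
  have "(norm (x - reflect lam y))\<^sup>2 =
      (norm (x - y))\<^sup>2 - 2 * t * inner (x - y) (axis k 1) + t\<^sup>2 * (norm (axis k (1::real) :: real ^ 'n))\<^sup>2"
    unfolding eq power2_norm_eq_inner
    by (rule inner_diff_scaleR_self)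
  then have "(norm (x - reflect lam y))\<^sup>2 = (norm (x - y))\<^sup>2 - 2 * t * (x $ k - y $ k) + t\<^sup>2"
    by (simp add: inner_axis)
  then show ?thesis by (simp add: t_def power2_eq_square algebra_simps)
qed

lemma norm_refl_diff: "norm (reflect lam x - reflect lam y) = norm (x - y)"
proof -
  have "(norm (reflect lam x - reflect lam y))\<^sup>2 =
      (norm (y - reflect lam x))\<^sup>2 + 4 * (x $ k - lam) * (lam - y $ k)"
    using norm_diff_refl_sq[of "reflect lam x" lam y] by (simp add: reflect_nth norm_minus_commute)
  also have "\<dots> = (norm (y - x))\<^sup>2"
    unfolding norm_diff_refl_sq[of y] by algebra
  finally show ?thesis by (simp add: norm_minus_commute)
qed

lemma continuous_refl [continuous_intros]: "continuous_on S (reflect lam)"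
  unfolding reflect_def by (intro continuous_intros)

lemma measurable_refl [measurable]: "reflect lam \<in> borel_measurable borel"
  by (intro borel_measurable_continuous_onI continuous_refl)

lemma distr_refl: "distr lborel borel (reflect lam) = lborel"
proof -
  \<comment> \<open>The reflection is written as a diagonal affine map with sign \<open>-1\<close>
    on \<open>axis k 1\<close> only, the form in which the change of variables applies.\<close>
  define c :: "real ^ 'n \<Rightarrow> real" where "c j = (if j = axis k 1 then -1 else 1)" for j
  have ax: "axis k 1 \<in> (Basis :: (real ^ 'n) set)" by (simp add: axis_in_Basis_iff)
  have "(\<Sum>j\<in>Basis. (c j * (x \<bullet> j)) *\<^sub>R j) = x - (2 * x $ k) *\<^sub>R axis k 1" for x :: "real ^ 'n"
  proof -
    have "(\<Sum>j\<in>Basis. (c j * (x \<bullet> j)) *\<^sub>R j) =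
        (\<Sum>j\<in>Basis. (x \<bullet> j) *\<^sub>R j - (if j = axis k 1 then (2 * (x \<bullet> j)) *\<^sub>R j else 0))"
      by (intro sum.cong) (auto simp: c_def vec_eq_iff algebra_simps)
    also have "\<dots> = x - (2 * x $ k) *\<^sub>R axis k 1"
      using ax by (simp add: sum_subtractf euclidean_representation inner_axis)
    finally show ?thesis .
  qed
  then have T: "(\<lambda>x. (2 * lam) *\<^sub>R axis k 1 + (\<Sum>j\<in>Basis. (c j * (x \<bullet> j)) *\<^sub>R j)) = reflect lam"
    by (auto simp: reflect_def algebra_simps)
  have "(\<Prod>j\<in>Basis. \<bar>c j\<bar>) = 1" by (intro prod.neutral) (simp add: c_def)
  then show ?thesis
    using lborel_affine_euclidean[of c "(2 * lam) *\<^sub>R axis k 1"] unfolding T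
    by (simp add: c_def density_1)
qed

lemma integrable_refl:
  fixes f :: "real ^ 'n \<Rightarrow> real"
  assumes "integrable lborel f"
  shows "integrable lborel (\<lambda>x. f (reflect lam x))"
  using assms by (intro integrable_distr[where M'=borel and M=lborel]) (auto simp: distr_refl)

lemma integral_refl:
  fixes f :: "real ^ 'n \<Rightarrow> real"
  assumes "f \<in> borel_measurable borel"
  shows "(LINT x|lborel. f (reflect lam x)) = integral\<^sup>L lborel f"
  using integral_distr[of "reflect lam" lborel borel f] assms by (simp add: distr_refl)

text \<open>Reflection preserves the integrals, so integrating the inequality for pairs gives twice
  the claim. A point beyond the plane is covered by its mirror image.\<close>

lemma integral_le_by_reflection:
  fixes F E :: "real ^ 'n \<Rightarrow> real"
  assumes F: "integrable lborel F" and E: "integrable lborel E"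
    and le: "\<And>y. y $ k \<le> lam \<Longrightarrow> F y + F (reflect lam y) \<le> E y + E (reflect lam y)"
  shows "integral\<^sup>L lborel F \<le> integral\<^sup>L lborel E"
proof -
  have le': "F y + F (reflect lam y) \<le> E y + E (reflect lam y)" for y
  proof (cases "y $ k \<le> lam")
    case False
    then show ?thesis using le[of "reflect lam y"] by (simp add: reflect_nth add.commute)
  qed (rule le)
  have m: "F \<in> borel_measurable borel" "E \<in> borel_measurable borel"
    using F E by (simp_all add: borel_measurable_integrable[of lborel, simplified])
  have "(LINT y|lborel. F y + F (reflect lam y)) \<le> (LINT y|lborel. E y + E (reflect lam y))"
    using F E by (intro integral_mono le' Bochner_Integration.integrable_add integrable_refl)
  then show ?thesis
    using F E m by (simp add: integrable_refl integral_refl)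
qed


section \<open>Linearity and reflection of the fractional Laplacian\<close>

lemma has_frac_laplacian_uminus:
  fixes u :: "real ^ 'n \<Rightarrow> real"
  assumes "has_frac_laplacian c s u x l"
  shows "has_frac_laplacian c s (\<lambda>y. - u y) x (- l)"
proof (rule has_frac_laplacianI)
  have *: "indicator A y * ((- u x - - u y) * K (x - y)) = - (indicator A y * ((u x - u y) * K (x - y)))"
    for A y by (simp add: algebra_simps)
  show "integrable lborel (\<lambda>y. indicator (- ball x \<epsilon>) y * ((- u x - - u y) * K (x - y)))" if "0 < \<epsilon>" for \<epsilon>
    using has_frac_laplacian_integrable[OF assms that] unfolding * by simp
  show "((\<lambda>\<epsilon>. c * (LINT y|lborel. indicator (- ball x \<epsilon>) y * ((- u x - - u y) * K (x - y))))
      \<longlongrightarrow> - l) (at_right 0)"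
    using tendsto_minus[OF has_frac_laplacian_tendsto[OF assms]] unfolding * by simp
qed

lemma has_frac_laplacian_add:
  fixes u v :: "real ^ 'n \<Rightarrow> real"
  assumes "has_frac_laplacian c s u x l" "has_frac_laplacian c s v x l'"
  shows "has_frac_laplacian c s (\<lambda>y. u y + v y) x (l + l')"
proof (rule has_frac_laplacianI)
  have *: "indicator A y * ((u x + v x - (u y + v y)) * K (x - y)) =
      indicator A y * ((u x - u y) * K (x - y)) + indicator A y * ((v x - v y) * K (x - y))"
    for A y by (simp add: algebra_simps)
  show "integrable lborel (\<lambda>y. indicator (- ball x \<epsilon>) y * ((u x + v x - (u y + v y)) * K (x - y)))"
    if "0 < \<epsilon>" for \<epsilon>
    using has_frac_laplacian_integrable[OF assms(1) that] has_frac_laplacian_integrable[OF assms(2) that]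
    unfolding * by simp
  have "((\<lambda>\<epsilon>. c * (LINT y|lborel. indicator (- ball x \<epsilon>) y * ((u x - u y) * K (x - y))) +
        c * (LINT y|lborel. indicator (- ball x \<epsilon>) y * ((v x - v y) * K (x - y)))) \<longlongrightarrow> l + l') (at_right 0)"
    by (intro tendsto_add has_frac_laplacian_tendsto assms)
  then show "((\<lambda>\<epsilon>. c * (LINT y|lborel. indicator (- ball x \<epsilon>) y * ((u x + v x - (u y + v y)) * K (x - y))))
      \<longlongrightarrow> l + l') (at_right 0)"
  proof (rule Lim_transform_eventually)
    show "\<forall>\<^sub>F \<epsilon> in at_right 0. c * (LINT y|lborel. indicator (- ball x \<epsilon>) y * ((u x - u y) * K (x - y))) +
        c * (LINT y|lborel. indicator (- ball x \<epsilon>) y * ((v x - v y) * K (x - y))) =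
        c * (LINT y|lborel. indicator (- ball x \<epsilon>) y * ((u x + v x - (u y + v y)) * K (x - y)))"
      using has_frac_laplacian_integrable[OF assms(1)] has_frac_laplacian_integrable[OF assms(2)]
      unfolding * by (subst eventually_at_right[of 0 1]) (auto intro!: exI[of _ 1] simp: distrib_left)
  qed
qed

lemma has_frac_laplacian_const_diff:
  fixes u :: "real ^ 'n \<Rightarrow> real"
  assumes "has_frac_laplacian c s u x l"
  shows "has_frac_laplacian c s (\<lambda>y. C - u y) x (- l)"
  using has_frac_laplacian_uminus[OF assms] unfolding has_frac_laplacian_def frac_kernel_diff_def
  by simp

lemma has_frac_laplacian_refl:
  assumes "has_frac_laplacian c s u (reflect lam x) l" and [measurable]: "u \<in> borel_measurable borel"
  shows "has_frac_laplacian c s (\<lambda>y. u (reflect lam y)) x l"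
proof (rule has_frac_laplacianI)
  let ?f = "\<lambda>\<epsilon> y. indicator (- ball (reflect lam x) \<epsilon>) y * ((u (reflect lam x) - u y) * K (reflect lam x - y))"
  have *: "indicator (- ball x \<epsilon>) y * ((u (reflect lam x) - u (reflect lam y)) * K (x - y)) = ?f \<epsilon> (reflect lam y)"
    for \<epsilon> y by (simp add: indicator_def dist_norm norm_refl_diff K_def)
  have m: "?f \<epsilon> \<in> borel_measurable borel" for \<epsilon> by measurable
  show "integrable lborel (\<lambda>y. indicator (- ball x \<epsilon>) y * ((u (reflect lam x) - u (reflect lam y)) * K (x - y)))"
    if "0 < \<epsilon>" for \<epsilon>
    unfolding * by (rule integrable_refl[OF has_frac_laplacian_integrable[OF assms(1) that]])
  show "((\<lambda>\<epsilon>. c * (LINT y|lborel. indicator (- ball x \<epsilon>) y * ((u (reflect lam x) - u (reflect lam y)) * K (x - y))))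
      \<longlongrightarrow> l) (at_right 0)"
    unfolding * integral_refl[OF m] by (rule has_frac_laplacian_tendsto[OF assms(1)])
qed

text \<open>A perturbation of height \<open>b\<close> and radius \<open>r\<close> costs at most \<open>cost_const * b * r\<^sup>-\<^sup>2\<^sup>s\<close> in the
  fractional Laplacian; a value \<open>-m\<close> of an antisymmetric function at depth \<open>d\<close> gains at least
  \<open>depth_const * m * d\<^sup>-\<^sup>2\<^sup>s\<close>.\<close>

definition cost_const :: real where "cost_const = core_const + 3 * unit_vol + 2 * tail_const"
definition depth_const :: real where "depth_const = 2 * 3 powr (- kexp) * unit_vol"

lemma cost_const_pos: "0 < cost_const" and depth_const_pos: "0 < depth_const"
  using core_const_nonneg tail_const_nonneg unit_vol_pos by (auto simp: cost_const_def depth_const_def)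

section \<open>Touching estimates for antisymmetric functions\<close>

lemma dist_refl_ge:
  assumes "x $ k \<le> lam" "y $ k \<le> lam"
  shows norm_le_norm_refl: "norm (x - y) \<le> norm (x - reflect lam y)"
    and depth_le_norm_refl: "lam - x $ k \<le> norm (x - reflect lam y)"
proof -
  have "(norm (x - y))\<^sup>2 \<le> (norm (x - reflect lam y))\<^sup>2"
    using assms by (simp add: norm_diff_refl_sq)
  then show "norm (x - y) \<le> norm (x - reflect lam y)" by simp
  have "lam - x $ k \<le> \<bar>(x - reflect lam y) $ k\<bar>" using assms by (simp add: reflect_nth)
  also have "\<dots> \<le> norm (x - reflect lam y)" by (rule component_le_norm_cart)
  finally show "lam - x $ k \<le> norm (x - reflect lam y)" .
qed

text \<open>The function \<open>w\<close> is not bounded below by \<open>-m0\<close> beyond the plane, so the integrand itself has no useful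
  majorant. Only the sum \<open>F(y) + F(y\<^sup>\<lambda>)\<close> over mirror pairs is compared with \<open>E(y) + E(y\<^sup>\<lambda>)\<close>, for an
  \<open>E\<close> that may be chosen without any symmetry.\<close>

lemma antisymmetric_touch:
  assumes c: "0 < c" and lap: "has_frac_laplacian c s w x l"
    and [measurable]: "w \<in> borel_measurable borel"
    and W: "\<And>y. \<bar>w y\<bar> \<le> W"
    and anti: "\<And>y. w (reflect lam y) = - w y"
    and m0: "0 \<le> m0" and low: "\<And>y. y $ k \<le> lam \<Longrightarrow> - m0 \<le> w y"
    and x: "w x < - m0 + b" and b: "0 < b" and r: "0 < r" "r \<le> lam - x $ k"
    and e: "norm e \<le> r"
    and touch: "\<And>y. y $ k \<le> lam \<Longrightarrow> w x - w y \<le> b / r\<^sup>2 * ((norm (x - y))\<^sup>2 + 2 * inner (y - x) e)"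
    and A[measurable]: "A \<in> sets borel" and Ab: "bounded A" and J0: "0 \<le> J0"
    and AJ: "\<And>y. y \<in> A \<Longrightarrow> y $ k < lam \<and> y \<notin> ball x r \<and> J0 \<le> K (x - y) - K (x - reflect lam y)"
  shows "l \<le> c * (cost_const * b * r powr (- 2 * s) - depth_const * m0 * (lam - x $ k) powr (- 2 * s)
    - J0 * (LINT y|lborel. indicator A y * (w y + m0)))"
proof -
  define d where "d = lam - x $ k"
  have d: "0 < d" "r \<le> d" "x $ k < lam" using r by (auto simp: d_def)
  \<comment> \<open>Inside \<open>ball x r\<close> the touching bound is at least
    \<open>- 3 * b\<close>; \<open>\<kappa>1\<close> covers its product with the mirror
    kernel.\<close>
  define \<kappa>1 where "\<kappa>1 = 3 * b * d powr (- kexp)"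
  define D0 where "D0 = (3 * d) powr (- kexp)"
  \<comment> \<open>\<open>\<kappa>2\<close> pays for pairs in which \<open>y\<close> is excised but
    its mirror is not: the first summand bounds the surviving term, the second offsets
    \<open>e4\<close>.\<close>
  define \<kappa>2 where "\<kappa>2 = 2 * W * d powr (- kexp) + 2 * m0 * D0"
  \<comment> \<open>The mirror image of \<open>x\<close>. The ball of radius \<open>d\<close> about
    it lies beyond the plane and within \<open>3 * d\<close> of \<open>x\<close>; it produces the
    gain measured by \<open>depth_const\<close>.\<close>
  define z where "z = x + (2 * d) *\<^sub>R axis k 1"
  have W0: "0 \<le> W" using W[of x] by linarith
  have k0: "0 \<le> \<kappa>1" "0 \<le> D0" "0 \<le> \<kappa>2" using b m0 W0 by (auto simp: \<kappa>1_def D0_def \<kappa>2_def)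
  have zD: "lam < y $ k" "norm (x - y) \<le> 3 * d" "y \<noteq> x" "D0 \<le> K (x - y)" if "y \<in> ball z d" for y
  proof -
    have "\<bar>(z - y) $ k\<bar> < d"
      using that component_le_norm_cart[of "z - y" k] by (simp add: dist_norm)
    then show g: "lam < y $ k" by (auto simp: z_def d_def)
    have "norm (x - y) \<le> norm (x - z) + norm (z - y)" by norm
    also have "norm (x - z) = 2 * d" using d by (simp add: z_def)
    finally show n: "norm (x - y) \<le> 3 * d" using that by (simp add: dist_norm)
    show "y \<noteq> x" using g d by auto
    then show "D0 \<le> K (x - y)" unfolding D0_def using n by (intro K_ge) auto
  qed
  \<comment> \<open>\<open>e1\<close> and \<open>e3\<close> are the near and far costs,
    \<open>e2\<close> and \<open>e5\<close> the corrections just described, \<open>e4\<close> and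
    \<open>e6\<close> the gains from the mirror ball and from \<open>A\<close>.\<close>
  define e1 where "e1 \<epsilon> y = indicator (ball x r - ball x \<epsilon>) y *
      (b / r\<^sup>2 * ((norm (x - y))\<^sup>2 + 2 * inner (y - x) e) * K (x - y))" for \<epsilon> y
  define e2 where "e2 y = indicator (ball x r) y * \<kappa>1" for y
  define e3 where "e3 y = (2 * b) * (indicator (- ball x r) y * K (x - y))" for y
  define e4 where "e4 y = indicator (ball z d) y * (2 * m0 * D0)" for y
  define e5 where "e5 \<epsilon> y = indicator (ball x \<epsilon>) y * \<kappa>2" for \<epsilon> y
  define e6 where "e6 y = J0 * (indicator A y * (w y + m0))" for y
  have br: "0 \<le> b / r\<^sup>2" using b by simp
  have iA: "integrable lborel (\<lambda>y. indicator A y * (w y + m0))"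
  proof (rule integrable_indicator_bounded[OF _ A Ab])
    show "\<bar>w y + m0\<bar> \<le> W + m0" for y using W[of y] m0 by linarith
  qed measurable
  show ?thesis
  proof (rule has_frac_laplacian_le[OF lap _ r(1), where \<kappa> = "unit_vol * \<kappa>2"])
    fix \<epsilon> :: real assume \<epsilon>: "0 < \<epsilon>" "\<epsilon> < r"
    let ?F = "\<lambda>y. indicator (- ball x \<epsilon>) y * ((w x - w y) * K (x - y))"
    let ?E = "\<lambda>y. e1 \<epsilon> y + e2 y + e3 y - e4 y + e5 \<epsilon> y - e6 y"
    have I: "integrable lborel (e1 \<epsilon>)" "integrable lborel e2" "integrable lborel e3"
        "integrable lborel e4" "integrable lborel (e5 \<epsilon>)" "integrable lborel e6"
      unfolding e1_def e2_def e3_def e4_def e5_def e6_def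
      using annulus_quadratic_integrable[OF \<epsilon>(1) r(1) br] integrable_ball_const(1) r d \<epsilon> iA
        tail_at_integrable by auto
    have "integral\<^sup>L lborel ?F \<le> integral\<^sup>L lborel ?E"
    proof (rule integral_le_by_reflection[where lam = lam])
      show "integrable lborel ?F" by (rule has_frac_laplacian_integrable[OF lap \<epsilon>(1)])
      show "integrable lborel ?E" using I by auto
      fix y assume y: "y $ k \<le> lam"
      let ?y = "reflect lam y"
      let ?K = "K (x - y)" and ?L = "K (x - ?y)"
      have dy: "d \<le> norm (x - ?y)" and ny: "norm (x - y) \<le> norm (x - ?y)"
        using y d dist_refl_ge[of x lam y] by (auto simp: d_def)
      have out: "?y \<notin> ball x r" "?y \<notin> ball x \<epsilon>" using dy d \<epsilon> by (auto simp: dist_norm)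
      have L: "?L \<le> d powr (- kexp)" using dy d by (intro K_le) auto
      have y4: "y \<notin> ball z d" using zD(1)[of y] y by force
      have lam_y: "w x - w y \<le> b" using low[OF y] x by linarith
      have Ly: "e4 ?y \<le> 2 * m0 * ?L"
        using zD(4)[of ?y] m0 by (auto simp: e4_def indicator_def mult_left_mono)
      have Ly': "e4 ?y \<le> 2 * m0 * D0"
        using m0 k0 by (auto simp: e4_def indicator_def)
      \<comment> \<open>Unless \<open>y\<close> is excised, antisymmetry makes the left side
        \<open>(w x - w y) * (?K - ?L) + 2 * w x * ?L\<close>. Touching, or the bound
        \<open>b\<close>, controls the first term; the second yields the gain
        \<open>2 * m0 * ?L\<close>.\<close>
      show "?F y + ?F ?y \<le> ?E y + ?E ?y"
      proof (cases "y $ k = lam")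
        case True
        then have yy: "?y = y" by (rule reflect_hyperplane)
        then have "w y = 0" using anti[of y] by simp
        moreover have "y \<notin> A" using AJ True by auto
        moreover have "(w x) * ?K \<le> (2 * b) * ?K" using x m0 b by (intro mult_right_mono) auto
        ultimately show ?thesis
          using out y4 unfolding yy
          by (simp add: e1_def e2_def e3_def e4_def e5_def e6_def)
      next
        case False
        then have yA: "?y \<notin> A" using AJ[of ?y] y by (auto simp: reflect_nth)
        have Ey: "?E ?y = 2 * b * ?L - e4 ?y"
          using out yA by (simp add: e1_def e2_def e3_def e5_def e6_def)
        have Fy: "?F ?y = (w x + w y) * ?L" using out by (simp add: anti)
        have wxL: "2 * w x * ?L \<le> 2 * b * ?L - 2 * m0 * ?L"
          using mult_right_mono[of "2 * w x" "2 * b - 2 * m0" ?L] x by (simp add: left_diff_distrib)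
        show ?thesis
        proof (cases "y \<in> ball x r")
          case in_r: True
          then have yA': "y \<notin> A" using AJ[of y] by auto
          show ?thesis
          proof (cases "y \<in> ball x \<epsilon>")
            case True
            have "(w x + w y) * ?L \<le> (2 * W) * d powr (- kexp)"
              using W[of x] W[of y] L W0 by (intro mult_mono) auto
            moreover have "?E y = \<kappa>1 + \<kappa>2"
              using True in_r yA' y4 by (simp add: e1_def e2_def e3_def e4_def e5_def e6_def)
            moreover have "?F y = 0" using True by simp
            moreover have "0 \<le> 2 * b * ?L" using b by simp
            ultimately show ?thesis
              using Ey Fy k0(1) Ly' unfolding \<kappa>2_def by linarith
          next
            case False
            define th where "th = b / r\<^sup>2 * ((norm (x - y))\<^sup>2 + 2 * inner (y - x) e)"
            have KL: "0 \<le> ?K - ?L"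
            proof (cases "x = y")
              case True then show ?thesis using False \<epsilon> by simp
            next
              case False then show ?thesis using K_antimono[of "x - y" "x - ?y"] ny by simp
            qed
            have "\<bar>inner (y - x) e\<bar> \<le> norm (y - x) * norm e" by (rule Cauchy_Schwarz_ineq2)
            also have "\<dots> \<le> r * r"
              using in_r e r by (intro mult_mono) (auto simp: dist_norm norm_minus_commute)
            finally have "\<bar>inner (y - x) e\<bar> \<le> r\<^sup>2" by (simp add: power2_eq_square)
            then have "- (3 * r\<^sup>2) \<le> (norm (x - y))\<^sup>2 + 2 * inner (y - x) e" 
              using zero_le_power2[of "norm (x - y)"] zero_le_power2[of r] by linarith
            then have "b / r\<^sup>2 * (- (3 * r\<^sup>2)) \<le> th" unfolding th_def by (rule mult_left_mono[OF _ br])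
            then have th3: "- th \<le> 3 * b" using r by simp
            have "(w x - w y) * (?K - ?L) \<le> th * (?K - ?L)"
              unfolding th_def by (rule mult_right_mono[OF touch[OF y] KL])
            moreover have "- th * ?L \<le> \<kappa>1"
              unfolding \<kappa>1_def using th3 L b by (intro order_trans[OF mult_right_mono[OF th3]] mult_left_mono) auto
            moreover have "?E y = th * ?K + \<kappa>1"
              using False in_r yA' y4 by (simp add: e1_def e2_def e3_def e4_def e5_def e6_def th_def)
            moreover have "?F y = (w x - w y) * ?K" using False by simp
            ultimately show ?thesis
              unfolding Ey Fy using wxL Ly by (simp add: algebra_simps)
          qed
        next
          case False
          then have nb: "y \<notin> ball x \<epsilon>" using \<epsilon> by auto
          have KL: "0 \<le> ?K - ?L"
            using K_antimono[of "x - y" "x - ?y"] ny False r by (cases "x = y") auto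
          have wm: "0 \<le> w y + m0" "w y + m0 \<le> w y - w x + b" using low[OF y] x by auto
          have "e6 y \<le> (w y - w x + b) * (?K - ?L)"
          proof (cases "y \<in> A")
            case True
            have "J0 * (w y + m0) \<le> (?K - ?L) * (w y - w x + b)"
              using AJ[OF True] wm J0 KL by (intro mult_mono) auto
            then show ?thesis using True by (simp add: e6_def mult.commute)
          qed (use KL wm in \<open>simp add: e6_def\<close>)
          moreover have "?E y = 2 * b * ?K - e6 y"
            using False nb y4 by (simp add: e1_def e2_def e3_def e4_def e5_def)
          moreover have "?F y = (w x - w y) * ?K" using nb by simp
          moreover have "0 \<le> b * ?K" "0 \<le> b * ?L" using b by auto
          ultimately show ?thesis
            unfolding Ey Fy using wxL Ly by (simp add: algebra_simps)
        qed
      qed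
    qed
    also have "integral\<^sup>L lborel ?E = integral\<^sup>L lborel (e1 \<epsilon>) + integral\<^sup>L lborel e2 +
        integral\<^sup>L lborel e3 - integral\<^sup>L lborel e4 + integral\<^sup>L lborel (e5 \<epsilon>) - integral\<^sup>L lborel e6"
      using I by simp
    also have "integral\<^sup>L lborel (e1 \<epsilon>) \<le> b * core_const * r powr (- 2 * s)"
    proof -
      have "integral\<^sup>L lborel (e1 \<epsilon>) \<le> b / r\<^sup>2 * core_const * (r\<^sup>2 * r powr (- 2 * s))"
        unfolding e1_def by (rule annulus_quadratic_integral[OF \<epsilon>(1) r(1) br])
      then show ?thesis using r by (simp add: field_simps)
    qed
    also have "integral\<^sup>L lborel e2 \<le> 3 * b * unit_vol * r powr (- 2 * s)"
    proof -
      have "integral\<^sup>L lborel e2 = unit_vol * r ^ CARD('n) * (3 * b * d powr (- kexp))"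
        unfolding e2_def \<kappa>1_def using r by (intro integrable_ball_const(2)) auto
      also have "\<dots> \<le> unit_vol * r ^ CARD('n) * (3 * b * r powr (- kexp))"
        using unit_vol_pos r b d kexp_pos by (intro mult_left_mono powr_mono2') auto
      finally show ?thesis using card_powr[OF r(1)] by (simp add: mult_ac)
    qed
    also have "integral\<^sup>L lborel e3 = 2 * b * tail_const * r powr (- 2 * s)"
      unfolding e3_def using tail_at_integral[OF r(1)] by simp
    also have "integral\<^sup>L lborel e4 = depth_const * m0 * d powr (- 2 * s)"
    proof -
      have "integral\<^sup>L lborel e4 = unit_vol * d ^ CARD('n) * (2 * m0 * D0)"
        unfolding e4_def using d by (intro integrable_ball_const(2)) auto
      then show ?thesis
        using card_powr[OF d(1)] d by (simp add: depth_const_def D0_def powr_mult mult_ac)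
    qed
    also have "integral\<^sup>L lborel (e5 \<epsilon>) = unit_vol * \<kappa>2 * \<epsilon> ^ CARD('n)"
      unfolding e5_def using integrable_ball_const(2)[of \<epsilon> x] \<epsilon> by (simp add: mult_ac)
    also have "integral\<^sup>L lborel e6 = J0 * (LINT y|lborel. indicator A y * (w y + m0))"
      unfolding e6_def by simp
    finally show "integral\<^sup>L lborel ?F \<le> cost_const * b * r powr (- 2 * s) - depth_const * m0 * (lam - x $ k) powr (- 2 * s)
        - J0 * (LINT y|lborel. indicator A y * (w y + m0)) + unit_vol * \<kappa>2 * \<epsilon> ^ CARD('n)"
      by (simp add: cost_const_def d_def algebra_simps)
  qed (use c in simp)
qed

text \<open>Penalised minimum over the half-space, followed by the touching estimate;
  \<open>2 * r\<close> is at most the depth of \<open>x0\<close>, so \<open>x\<close> stays deeper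
  than \<open>r\<close>. \<open>A\<close> remains quantified after \<open>x\<close>: the empty set
  gives the plain estimate, a ball adds the mass of \<open>w + m0\<close> as a gain.\<close>

lemma antisymmetric_min:
  assumes c: "0 < c" and lap: "\<And>x. x $ k < lam \<Longrightarrow> has_frac_laplacian c s w x (l x)"
    and w: "continuous_on UNIV w"
    and W: "\<And>y. \<bar>w y\<bar> \<le> W"
    and anti: "\<And>y. w (reflect lam y) = - w y"
    and m0: "0 \<le> m0" and low: "\<And>y. y $ k \<le> lam \<Longrightarrow> - m0 \<le> w y"
    and x0: "w x0 < - m0 + b" and r: "0 < r" "2 * r \<le> lam - x0 $ k"
  obtains x where "x \<in> ball x0 r" "r < lam - x $ k" "lam - x $ k < lam - x0 $ k + r" "w x \<le> w x0"
    "\<And>A J0. A \<in> sets borel \<Longrightarrow> bounded A \<Longrightarrow> 0 \<le> J0 \<Longrightarrow>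
      (\<And>y. y \<in> A \<Longrightarrow> y $ k < lam \<and> y \<notin> ball x r \<and> J0 \<le> K (x - y) - K (x - reflect lam y)) \<Longrightarrow>
      l x \<le> c * (cost_const * b * r powr (- 2 * s) - depth_const * m0 * (lam - x $ k) powr (- 2 * s)
        - J0 * (LINT y|lborel. indicator A y * (w y + m0)))"
proof -
  have b: "0 < b" using x0 low[of x0] r by auto
  have cl: "closed {y :: real ^ 'n. y $ k \<le> lam}"
    by (intro closed_Collect_le continuous_intros)
  obtain x where x: "x \<in> ball x0 r" "w x \<le> w x0"
      and touch: "\<And>y. y \<in> {y. y $ k \<le> lam} \<Longrightarrow>
        w x - w y \<le> b / r\<^sup>2 * ((norm (x - y))\<^sup>2 + 2 * inner (y - x) (x - x0))"
  proof (rule perturbed_min[OF cl _ w, of x0 m0 b r])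
    show "x0 \<in> {y. y $ k \<le> lam}" using r by simp
  qed (use low x0 r in auto)
  have "\<bar>(x0 - x) $ k\<bar> < r"
    using x component_le_norm_cart[of "x0 - x" k] by (simp add: dist_norm)
  then have d: "r < lam - x $ k" "lam - x $ k < lam - x0 $ k + r" using r by auto
  have "w \<in> borel_measurable borel" using w by (rule borel_measurable_continuous_onI)
  moreover have "w x < - m0 + b" "norm (x - x0) \<le> r" "r \<le> lam - x $ k" "x $ k < lam"
    using x d x0 r by (auto simp: dist_norm norm_minus_commute)
  ultimately show ?thesis
    using touch
    by (intro that[OF x(1) d x(2)] antisymmetric_touch[OF c lap _ W anti m0 low _ b r(1)]) simp_all
qed

end

section \<open>Moving planes\<close>

text \<open>The data in quantitative form: \<open>M\<close> bounds \<open>u\<close>,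
  \<open>L\<close> is a Lipschitz constant of \<open>f\<close> up to \<open>M\<close>, and
  \<open>f_flat\<close> is the vanishing two-point difference quotient at the origin, multiplied out
  so that \<open>a = b\<close> is allowed.\<close>

locale bounded_solution = frac_kernel s k for s :: real and k :: "'n::finite" +
  fixes c M L :: real and h f :: "real \<Rightarrow> real" and u :: "real ^ 'n \<Rightarrow> real"
  assumes c: "0 < c" and h_mono: "mono h" and h_0: "h 0 = 0" and h_pos: "\<And>t. 0 < t \<Longrightarrow> 0 < h t"
    and h_top: "filterlim h at_top at_top"
    and f_mono: "mono_on {0..} f" and f_pos: "\<And>t. 0 < t \<Longrightarrow> 0 < f t"
    and L: "0 < L"
    and f_lip: "\<And>a b. 0 \<le> a \<Longrightarrow> a \<le> M \<Longrightarrow> 0 \<le> b \<Longrightarrow> b \<le> M \<Longrightarrow> \<bar>f a - f b\<bar> \<le> L * \<bar>a - b\<bar>"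
    and f_flat: "\<And>\<eta>. 0 < \<eta> \<Longrightarrow> \<exists>\<delta>>0. \<forall>a b. 0 \<le> a \<and> a < \<delta> \<and> 0 \<le> b \<and> b < \<delta> \<longrightarrow>
      \<bar>f a - f b\<bar> \<le> \<eta> * \<bar>a - b\<bar>"
    and u_cont: "continuous_on UNIV u" and u_pos: "\<And>x. 0 < u x" and u_le: "\<And>x. u x \<le> M"
    and u_eq: "\<And>x. has_frac_laplacian c s u x (h (x $ k) * f (u x))"
begin

section \<open>Elementary bounds for the solution\<close>

lemma M_pos: "0 < M" using u_pos[of 0] u_le[of 0] by linarith

lemma f_u_pos: "0 < f (u x)" using u_pos by (rule f_pos)

lemma f_le: "0 \<le> a \<Longrightarrow> a \<le> b \<Longrightarrow> f a \<le> f b"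
  using f_mono by (auto simp: mono_on_def)

lemma h_le: "t \<le> t' \<Longrightarrow> h t \<le> h t'" using h_mono by (rule monoD)

lemma h_nonneg: "0 \<le> t \<Longrightarrow> 0 \<le> h t" and h_nonpos: "t \<le> 0 \<Longrightarrow> h t \<le> 0"
  using h_le[of 0 t] h_le[of t 0] h_0 by simp_all

lemma u_meas [measurable]: "u \<in> borel_measurable borel"
  using u_cont by (rule borel_measurable_continuous_onI)

lemma u_integrable: "integrable lborel (\<lambda>y. indicator (ball x r) y * u y)"
proof (rule integrable_indicator_bounded)
  show "\<bar>u y\<bar> \<le> M" for y using u_pos[of y] u_le[of y] by simp
qed auto

section \<open>Pointwise and mass estimates for the solution\<close>

text \<open>As \<open>u > 0\<close>, touching at height \<open>b\<close> costs a multiple of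
  \<open>b\<close>, while mass of \<open>u\<close> elsewhere lowers the fractional Laplacian. Where
  the equation has a nonnegative right-hand side, mass bounds \<open>b\<close> from below; with
  \<open>J0 = 0\<close> the right-hand side itself is bounded.\<close>

lemma supersolution_touch:
  assumes b: "u p < b" and r: "0 < r"
  obtains x where "x \<in> ball p r" "u x \<le> u p"
    "\<And>z \<rho> J0. 0 \<le> J0 \<Longrightarrow> (\<And>y. y \<in> ball z \<rho> \<Longrightarrow> y \<notin> ball x r \<and> J0 \<le> K (x - y)) \<Longrightarrow>
      h (x $ k) * f (u x) \<le> c * (b * (core_const + tail_const) * r powr (- 2 * s) -
        J0 * (LINT y|lborel. indicator (ball z \<rho>) y * u y))"
proof -
  obtain x where x: "x \<in> ball p r" "u x \<le> u p"
    and touch: "\<And>y. y \<in> UNIV \<Longrightarrow> u x - u y \<le> b / r\<^sup>2 * ((norm (x - y))\<^sup>2 + 2 * inner (y - x) (x - p))"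
    by (rule perturbed_min[OF closed_UNIV UNIV_I u_cont, of 0 p b r])
      (use b r less_imp_le[OF u_pos] in simp_all)
  have b0: "0 < b" using b u_pos[of p] by linarith
  have "h (x $ k) * f (u x) \<le> c * (b * (core_const + tail_const) * r powr (- 2 * s) -
        J0 * (LINT y|lborel. indicator (ball z \<rho>) y * u y))"
    if J0: "0 \<le> J0" and J: "\<And>y. y \<in> ball z \<rho> \<Longrightarrow> y \<notin> ball x r \<and> J0 \<le> K (x - y)" for z \<rho> J0
  proof -
    have "(LINT y|lborel. indicator (- ball x r) y * ((u x - u y) * K (x - y))) \<le>
        (LINT y|lborel. b * (indicator (- ball x r) y * K (x - y)) - J0 * (indicator (ball z \<rho>) y * u y))"
    proof (rule integral_mono)
      fix y
      have "u x * K (x - y) \<le> b * K (x - y)" using x b by (intro mult_right_mono) auto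
      moreover have "J0 * u y \<le> K (x - y) * u y" if "y \<in> ball z \<rho>"
        using J[OF that] u_pos[of y] by (intro mult_right_mono) auto
      moreover have "0 \<le> K (x - y) * u y" using u_pos[of y] by simp
      ultimately show "indicator (- ball x r) y * ((u x - u y) * K (x - y)) \<le>
          b * (indicator (- ball x r) y * K (x - y)) - J0 * (indicator (ball z \<rho>) y * u y)"
        using J[of y] by (cases "y \<in> ball z \<rho>"; cases "y \<in> ball x r") (auto simp: algebra_simps)
    qed (use has_frac_laplacian_integrable[OF u_eq r] tail_at_integrable[OF r] u_integrable in auto)
    also have "\<dots> = b * tail_const * r powr (- 2 * s) - J0 * (LINT y|lborel. indicator (ball z \<rho>) y * u y)"
      using tail_at_integrable[OF r, of x] u_integrable[of z \<rho>] tail_at_integral[OF r, of x] by simp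
    finally have I: "(LINT y|lborel. indicator (- ball x r) y * ((u x - u y) * K (x - y))) \<le>
      b * tail_const * r powr (- 2 * s) - J0 * (LINT y|lborel. indicator (ball z \<rho>) y * u y)" .
    have "h (x $ k) * f (u x) \<le> c * (b / r\<^sup>2 * core_const * (r\<^sup>2 * r powr (- 2 * s)) +
        (LINT y|lborel. indicator (- ball x r) y * ((u x - u y) * K (x - y))))"
      using b0 touch by (intro touch_below[OF c u_eq r, where e = "x - p"]) auto
    also have "b / r\<^sup>2 * core_const * (r\<^sup>2 * r powr (- 2 * s)) = b * core_const * r powr (- 2 * s)"
      using r by simp
    also have "c * (b * core_const * r powr (- 2 * s) +
        (LINT y|lborel. indicator (- ball x r) y * ((u x - u y) * K (x - y)))) \<le>
        c * (b * core_const * r powr (- 2 * s) + (b * tail_const * r powr (- 2 * s) -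
          J0 * (LINT y|lborel. indicator (ball z \<rho>) y * u y)))"
      using I c by (intro mult_left_mono add_left_mono) auto
    finally show ?thesis by (simp add: algebra_simps)
  qed
  with x show ?thesis by (rule that)
qed

text \<open>\<open>M - u\<close> is touched near \<open>x0\<close> at a point where
  \<open>u \<ge> \<delta>\<close>. There the kernel outside a ball of radius \<open>\<rho>\<close>
  contributes \<open>- \<delta> * tail_const * \<rho> powr (- 2 * s)\<close>. The right-hand side is
  bounded at heights up to \<open>t + 1\<close>, so for small \<open>\<rho>\<close> only nearby mass
  of \<open>u\<close> can compensate.\<close>

lemma mass_lower_bound:
  assumes \<delta>: "0 < \<delta>" and t: "0 \<le> t"
  obtains m where "0 < m"
    "\<And>x0. x0 $ k \<le> t \<Longrightarrow> \<delta> \<le> u x0 \<Longrightarrow> m \<le> (LINT y|lborel. indicator (ball x0 2) y * u y)"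
proof -
  \<comment> \<open>All bounded competing terms; the final \<open>1\<close> is the surplus that the
    mass has to supply.\<close>
  define B where "B = h (t + 1) * f M / c + M * core_const + M * tail_const + 1"
  have hf: "0 \<le> h (t + 1) * f M" using h_nonneg[of "t + 1"] f_pos[OF M_pos] t by simp
  then have B: "0 < B" using c M_pos core_const_nonneg tail_const_nonneg by (auto simp: B_def intro!: add_nonneg_pos)
  define Q where "Q = B / (\<delta> * tail_const)"
  \<comment> \<open>Chosen so that \<open>Q \<le> \<rho> powr (- 2 * s)\<close>; the cap at
    \<open>1\<close> makes \<open>\<rho> powr (2 - 2 * s)\<close> at most \<open>1\<close>.\<close>
  define \<rho> where "\<rho> = min 1 (Q powr (- 1 / (2 * s)))"
  have q: "0 < Q" using B \<delta> tail_const_pos by (simp add: Q_def)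
  then have \<rho>: "0 < \<rho>" "\<rho> \<le> 1" by (auto simp: \<rho>_def)
  have "(Q powr (- 1 / (2 * s))) powr (- 2 * s) \<le> \<rho> powr (- 2 * s)"
    using \<rho> s0 by (intro powr_mono2') (auto simp: \<rho>_def)
  then have "Q \<le> \<rho> powr (- 2 * s)" using q s0 by (simp add: powr_powr)
  then have \<rho>B: "B \<le> \<delta> * (tail_const * \<rho> powr (- 2 * s))" using \<delta> tail_const_pos by (simp add: Q_def field_simps)
  have "\<rho> powr kexp \<le> (LINT y|lborel. indicator (ball x0 2) y * u y)" (is "_ \<le> ?I")
    if x0: "x0 $ k \<le> t" "\<delta> \<le> u x0" for x0
  proof -
    let ?v = "\<lambda>y. M - u y"
    obtain x where x: "x \<in> ball x0 1" "?v x \<le> ?v x0" and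
      touch: "\<And>y. y \<in> UNIV \<Longrightarrow> ?v x - ?v y \<le> M / 1\<^sup>2 * ((norm (x - y))\<^sup>2 + 2 * inner (y - x) (x - x0))"
      by (rule perturbed_min[OF closed_UNIV UNIV_I, of ?v 0 x0 M 1])
        (use u_le u_pos u_cont in \<open>simp_all add: continuous_intros\<close>)
    have lap: "has_frac_laplacian c s ?v x (- (h (x $ k) * f (u x)))"
      by (rule has_frac_laplacian_const_diff[OF u_eq])
    have "\<bar>(x - x0) $ k\<bar> < 1"
      using x component_le_norm_cart[of "x - x0" k] by (simp add: dist_norm norm_minus_commute)
    then have xt: "x $ k \<le> t + 1" using x0 by auto
    have "h (x $ k) * f (u x) \<le> h (t + 1) * f (u x)"
      using f_u_pos[of x] h_le[OF xt] by (intro mult_right_mono) auto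
    also have "\<dots> \<le> h (t + 1) * f M"
      using h_nonneg[of "t + 1"] t f_le[of "u x" M] u_le u_pos[of x] by (intro mult_left_mono) auto
    finally have hx: "h (x $ k) * f (u x) \<le> h (t + 1) * f M" .
    have "- (h (x $ k) * f (u x)) \<le> c * (M * core_const * (\<rho>\<^sup>2 * \<rho> powr (- 2 * s)) +
        (LINT y|lborel. indicator (- ball x \<rho>) y * ((?v x - ?v y) * K (x - y))))"
      using touch M_pos by (intro touch_below[OF c lap \<rho>(1), where e = "x - x0"]) auto
    then have "- (h (t + 1) * f M) \<le> c * (M * core_const * (\<rho>\<^sup>2 * \<rho> powr (- 2 * s)) +
        (LINT y|lborel. indicator (- ball x \<rho>) y * ((?v x - ?v y) * K (x - y))))"
      using hx by linarith
    then have "- (h (t + 1) * f M / c) \<le> M * core_const * (\<rho>\<^sup>2 * \<rho> powr (- 2 * s)) +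
        (LINT y|lborel. indicator (- ball x \<rho>) y * ((?v x - ?v y) * K (x - y)))"
      using c by (simp add: field_simps)
    \<comment> \<open>Points at distance between \<open>\<rho>\<close> and \<open>1\<close> from
      \<open>x\<close> lie in \<open>ball x0 2\<close>, and the kernel is at most
      \<open>\<rho> powr (- kexp)\<close> there; farther out \<open>u \<le> M\<close>
      suffices.\<close>
    also have "(LINT y|lborel. indicator (- ball x \<rho>) y * ((?v x - ?v y) * K (x - y))) \<le>
        (LINT y|lborel. \<rho> powr (- kexp) * (indicator (ball x0 2) y * u y) +
          M * (indicator (- ball x 1) y * K (x - y)) - \<delta> * (indicator (- ball x \<rho>) y * K (x - y)))"
    proof (rule integral_mono)
      fix y
      have d: "dist x0 y < 2" if "dist x y < 1"
        using dist_triangle[of x0 y x] x that by simp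
      have 1: "u y * K (x - y) \<le> \<rho> powr (- kexp) * u y" if "y \<notin> ball x \<rho>"
        using that \<rho> u_pos[of y] K_le[of \<rho> "x - y"] by (auto simp: dist_norm)
      have 2: "u y * K (x - y) \<le> M * K (x - y)" using u_le by (intro mult_right_mono) auto
      have 3: "\<delta> * K (x - y) \<le> u x * K (x - y)" using x x0 by (intro mult_right_mono) auto
      have 4: "0 \<le> \<rho> powr (- kexp) * u y" "0 \<le> M * K (x - y)" using u_pos[of y] M_pos by auto
      show "indicator (- ball x \<rho>) y * ((?v x - ?v y) * K (x - y)) \<le>
          \<rho> powr (- kexp) * (indicator (ball x0 2) y * u y) +
          M * (indicator (- ball x 1) y * K (x - y)) - \<delta> * (indicator (- ball x \<rho>) y * K (x - y))"
      proof (cases "y \<in> ball x \<rho>")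
        case True
        then show ?thesis using 4 by (auto simp: indicator_def)
      next
        case False
        have eq: "(?v x - ?v y) * K (x - y) = u y * K (x - y) - u x * K (x - y)"
          by (simp add: algebra_simps)
        show ?thesis
          using False 1[OF False] 2 3 4 d unfolding eq
          by (cases "dist x0 y < 2"; cases "dist x y < 1") simp_all
      qed
    qed (use has_frac_laplacian_integrable[OF lap \<rho>(1)] tail_at_integrable \<rho> u_integrable in auto)
    also have "\<dots> = \<rho> powr (- kexp) * ?I + M * tail_const - \<delta> * (tail_const * \<rho> powr (- 2 * s))"
      using tail_at_integrable[of 1 x] tail_at_integral[of 1 x] tail_at_integrable[OF \<rho>(1), of x]
        tail_at_integral[OF \<rho>(1), of x] u_integrable[of x0 2] by simp
    finally have "\<delta> * (tail_const * \<rho> powr (- 2 * s)) \<le> h (t + 1) * f M / c +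
        M * core_const * (\<rho>\<^sup>2 * \<rho> powr (- 2 * s)) + \<rho> powr (- kexp) * ?I + M * tail_const"
      by simp
    moreover have "M * core_const * (\<rho>\<^sup>2 * \<rho> powr (- 2 * s)) \<le> M * core_const * 1"
    proof -
      have "\<rho>\<^sup>2 * \<rho> powr (- 2 * s) = \<rho> powr (2 - 2 * s)"
        using \<rho> powr_add[of \<rho> 2 "- 2 * s"] by simp
      also have "\<dots> \<le> 1" using \<rho> s1 by (intro powr_le1) auto
      finally show ?thesis using M_pos core_const_nonneg by (intro mult_left_mono) auto
    qed
    ultimately have "1 \<le> \<rho> powr (- kexp) * ?I" using \<rho>B by (simp add: B_def)
    then show ?thesis using \<rho> by (simp add: powr_minus field_simps)
  qed
  then show ?thesis using \<rho> by (intro that[of "\<rho> powr kexp"]) auto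
qed

section \<open>The reflected difference and its equation\<close>

definition w :: "real \<Rightarrow> real ^ 'n \<Rightarrow> real" where "w lam x = u (reflect lam x) - u x"

text \<open>The fractional Laplacian of \<open>w lam\<close>, as \<open>w_lap\<close> shows;
  \<open>2 * lam - x $ k\<close> is the height of the mirror point.\<close>

definition g :: "real \<Rightarrow> real ^ 'n \<Rightarrow> real" where
  "g lam x = h (2 * lam - x $ k) * f (u (reflect lam x)) - h (x $ k) * f (u x)"

definition ordered :: "real \<Rightarrow> bool" where
  "ordered lam \<longleftrightarrow> (\<forall>x. x $ k \<le> lam \<longrightarrow> u x \<le> u (reflect lam x))"

lemma w_lap: "has_frac_laplacian c s (w lam) x (g lam x)"
proof -
  have "has_frac_laplacian c s (\<lambda>y. u (reflect lam y)) x (h (reflect lam x $ k) * f (u (reflect lam x)))"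
    by (rule has_frac_laplacian_refl[OF u_eq u_meas])
  from has_frac_laplacian_add[OF this has_frac_laplacian_uminus[OF u_eq, of x]]
  show ?thesis by (simp add: w_def[abs_def] g_def reflect_nth)
qed

lemma w_cont: "continuous_on UNIV (w lam)"
  unfolding w_def by (intro continuous_intros continuous_on_compose2[OF u_cont] u_cont) auto

lemma w_meas [measurable]: "w lam \<in> borel_measurable borel"
  using w_cont by (rule borel_measurable_continuous_onI)

lemma w_bound: "\<bar>w lam y\<bar> \<le> M"
  using u_pos[of y] u_pos[of "reflect lam y"] u_le[of y] u_le[of "reflect lam y"] by (auto simp: w_def)

lemma w_anti: "w lam (reflect lam y) = - w lam y" by (simp add: w_def)

text \<open>Below the plane the mirror point is higher, so monotonicity of \<open>h\<close> and
  positivity of \<open>f (u _)\<close> allow the mirror coefficient to be lowered to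
  \<open>h (x $ k)\<close>.\<close>

lemma g_ge: "x $ k \<le> lam \<Longrightarrow> h (x $ k) * (f (u (reflect lam x)) - f (u x)) \<le> g lam x"
  using mult_right_mono[OF h_le[of "x $ k" "2 * lam - x $ k"], of "f (u (reflect lam x))"]
    f_u_pos[of "reflect lam x"] by (simp add: g_def algebra_simps)

lemma f_w_lip: "\<bar>f (u (reflect lam x)) - f (u x)\<bar> \<le> L * \<bar>w lam x\<bar>"
  unfolding w_def by (intro f_lip u_le less_imp_le[OF u_pos])

lemmas w_min = antisymmetric_min[OF c w_lap w_cont w_bound w_anti]

lemma component_dist: "\<bar>x $ k - y $ k\<bar> \<le> dist x (y :: real ^ 'n)"
  using component_le_norm_cart[of "x - y" k] by (simp add: dist_norm)

lemma reflect_dist: "dist (reflect lam x) (reflect lam y) = dist x y"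
  by (simp add: dist_norm norm_refl_diff)

lemma integral_ball_ge:
  fixes v :: "real ^ 'n \<Rightarrow> real"
  assumes "integrable lborel (\<lambda>y. indicator (ball x r) y * v y)" "0 \<le> r"
    and "\<And>y. y \<in> ball x r \<Longrightarrow> a \<le> v y"
  shows "unit_vol * r ^ CARD('n) * a \<le> (LINT y|lborel. indicator (ball x r) y * v y)"
proof -
  have "(LINT y|lborel. indicator (ball x r) y * a) \<le> (LINT y|lborel. indicator (ball x r) y * v y)"
    by (intro integral_mono integrable_ball_const(1) assms) (auto simp: indicator_def assms)
  then show ?thesis unfolding integrable_ball_const(2)[OF assms(2)] .
qed

lemma f_w_lip_le:
  assumes "\<bar>w lam x\<bar> \<le> b"
  shows "\<bar>f (u (reflect lam x)) - f (u x)\<bar> \<le> L * b"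
  using f_w_lip[of lam x] mult_left_mono[OF assms less_imp_le[OF L]] by (rule order_trans)

lemma w_integrable: "integrable lborel (\<lambda>y. indicator (ball x r) y * w lam y)"
  by (rule integrable_indicator_bounded[OF _ _ _ w_bound]) auto

section \<open>Propagation of lower bounds beyond the plane and back\<close>

text \<open>At nonnegative height the right-hand side of the equation is nonnegative, so mass near
  \<open>x0\<close> forces a pointwise bound far above. The shift \<open>2 * lam + 5\<close> puts
  the mirror of the new centre at height \<open>- x0 $ k - 5\<close>, well inside the region where
  \<open>h \<le> 0\<close>.\<close>

lemma far_lower_bound:
  assumes \<delta>: "0 < \<delta>" and lam: "0 \<le> lam"
  obtains c1 where "0 < c1" "\<And>x0 y. 0 \<le> x0 $ k \<Longrightarrow> x0 $ k \<le> lam + 1 \<Longrightarrow> \<delta> \<le> u x0 \<Longrightarrow>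
    dist (x0 + (2 * lam + 5) *\<^sub>R axis k 1) y < 1 \<Longrightarrow> c1 \<le> u y"
proof -
  obtain m where m: "0 < m"
    "\<And>x0. x0 $ k \<le> lam + 1 \<Longrightarrow> \<delta> \<le> u x0 \<Longrightarrow> m \<le> (LINT y|lborel. indicator (ball x0 2) y * u y)"
    using mass_lower_bound[OF \<delta>, of "lam + 1"] lam by auto
  define D where "D = 2 * lam + 5"
  \<comment> \<open>The touching point is within \<open>2\<close> of the shifted point, so
    \<open>D + 4\<close> bounds its distance to all of \<open>ball x0 2\<close>.\<close>
  define J0 where "J0 = (D + 4) powr (- kexp)"
  have D: "5 \<le> D" using lam by (simp add: D_def)
  have J0: "0 < J0" using D by (simp add: J0_def)
  have ST: "0 < core_const + tail_const" using core_const_nonneg tail_const_pos by simp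
  have "J0 * m / (core_const + tail_const) \<le> u p"
    if x0: "0 \<le> x0 $ k" "x0 $ k \<le> lam + 1" "\<delta> \<le> u x0" and p: "dist (x0 + D *\<^sub>R axis k 1) p < 1" for x0 p
  proof (rule dense_ge)
    \<comment> \<open>The touching estimate needs a strict inequality; \<open>b\<close> may be any
      number above \<open>u p\<close>.\<close>
    fix b assume b: "u p < b"
    obtain x where x: "x \<in> ball p 1" and le:
      "\<And>z \<rho> J0. 0 \<le> J0 \<Longrightarrow> (\<And>y. y \<in> ball z \<rho> \<Longrightarrow> y \<notin> ball x 1 \<and> J0 \<le> K (x - y)) \<Longrightarrow>
      h (x $ k) * f (u x) \<le> c * (b * (core_const + tail_const) * 1 powr (- 2 * s) -
        J0 * (LINT y|lborel. indicator (ball z \<rho>) y * u y))"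
      by (rule supersolution_touch[OF b, of 1]) auto
    have d: "dist (x0 + D *\<^sub>R axis k 1) x < 2"
      using dist_triangle[of "x0 + D *\<^sub>R axis k 1" x p] x p by simp
    then have "0 \<le> x $ k"
      using component_dist[of "x0 + D *\<^sub>R axis k 1" x] x0 D by simp
    then have "0 \<le> h (x $ k) * f (u x)" using h_nonneg f_u_pos less_imp_le[OF f_u_pos] by simp
    also have "\<dots> \<le> c * (b * (core_const + tail_const) * 1 powr (- 2 * s) -
        J0 * (LINT y|lborel. indicator (ball x0 2) y * u y))"
    proof (rule le)
      fix y assume y: "y \<in> ball x0 2"
      have t: "dist (x0 + D *\<^sub>R axis k 1) x0 = D" using D by (simp add: dist_norm)
      have 1: "1 \<le> dist x y"
        using dist_triangle[of "x0 + D *\<^sub>R axis k 1" x0 y] dist_triangle[of "x0 + D *\<^sub>R axis k 1" y x]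
          y d t D by (simp add: dist_commute)
      have 2: "dist x y \<le> D + 4"
        using dist_triangle[of x y x0] dist_triangle[of x x0 "x0 + D *\<^sub>R axis k 1"] y d t
        by (simp add: dist_commute)
      show "y \<notin> ball x 1 \<and> J0 \<le> K (x - y)"
        unfolding J0_def using 1 2 by (auto simp: dist_norm intro!: K_ge)
    qed (use J0 in simp)
    finally have "J0 * (LINT y|lborel. indicator (ball x0 2) y * u y) \<le> b * (core_const + tail_const)"
      using c by (simp add: zero_le_mult_iff)
    moreover have "J0 * m \<le> J0 * (LINT y|lborel. indicator (ball x0 2) y * u y)"
      using m(2)[OF x0(2,3)] J0 by simp
    ultimately show "J0 * m / (core_const + tail_const) \<le> b" using ST by (simp add: pos_divide_le_eq)
  qed
  then show ?thesis
    using J0 m ST by (intro that[of "J0 * m / (core_const + tail_const)"]) (auto simp: D_def)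
qed

text \<open>On the mirror ball heights are negative, so the term
  \<open>- h (x $ k) * f (u x)\<close> of \<open>g\<close> is nonnegative and the other is at least
  \<open>h 1 * f c1\<close>. As \<open>w lam \<ge> 0\<close> below the plane, a touching height
  \<open>b\<close> has to pay for this amount.\<close>

lemma reflected_lower_bound:
  assumes \<delta>: "0 < \<delta>" and lam: "0 \<le> lam" "ordered lam"
  obtains b0 where "0 < b0" "\<And>x0 y. 0 \<le> x0 $ k \<Longrightarrow> x0 $ k \<le> lam + 1 \<Longrightarrow> \<delta> \<le> u x0 \<Longrightarrow>
    dist (reflect lam (x0 + (2 * lam + 5) *\<^sub>R axis k 1)) y < 1 / 2 \<Longrightarrow> b0 \<le> w lam y"
proof -
  obtain c1 where c1: "0 < c1" "\<And>x0 y. 0 \<le> x0 $ k \<Longrightarrow> x0 $ k \<le> lam + 1 \<Longrightarrow> \<delta> \<le> u x0 \<Longrightarrow>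
    dist (x0 + (2 * lam + 5) *\<^sub>R axis k 1) y < 1 \<Longrightarrow> c1 \<le> u y"
    using far_lower_bound[OF \<delta> lam(1)] by blast
  define G where "G = h 1 * f c1"
  define Q where "Q = c * cost_const * (1 / 2) powr (- 2 * s)"
  have G: "0 < G" using h_pos[of 1] f_pos[OF c1(1)] by (simp add: G_def)
  have Q: "0 < Q" using c cost_const_pos by (simp add: Q_def)
  have low: "- 0 \<le> w lam y" if "y $ k \<le> lam" for y
    using lam(2) that by (auto simp: ordered_def w_def)
  have "G / Q \<le> w lam y"
    if x0: "0 \<le> x0 $ k" "x0 $ k \<le> lam + 1" "\<delta> \<le> u x0"
      and y: "dist (reflect lam (x0 + (2 * lam + 5) *\<^sub>R axis k 1)) y < 1 / 2" for x0 y
  proof (rule dense_ge)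
    let ?p = "x0 + (2 * lam + 5) *\<^sub>R axis k 1"
    fix b assume b: "w lam y < b"
    have pk: "reflect lam ?p $ k = - x0 $ k - 5" by (simp add: reflect_nth)
    have yk: "y $ k \<le> - 4" using component_dist[of y "reflect lam ?p"] y pk x0 by (simp add: dist_commute)
    obtain x where x: "x \<in> ball y (1 / 2)" and le:
      "\<And>A J0. A \<in> sets borel \<Longrightarrow> bounded A \<Longrightarrow> 0 \<le> J0 \<Longrightarrow>
      (\<And>y. y \<in> A \<Longrightarrow> y $ k < lam \<and> y \<notin> ball x (1 / 2) \<and> J0 \<le> K (x - y) - K (x - reflect lam y)) \<Longrightarrow>
      g lam x \<le> c * (cost_const * b * (1 / 2) powr (- 2 * s) - depth_const * 0 * (lam - x $ k) powr (- 2 * s)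
        - J0 * (LINT y|lborel. indicator A y * (w lam y + 0)))"
      by (rule w_min[OF order_refl low, of y b "1 / 2"]) (use b yk lam in auto)
    have dx: "dist (reflect lam ?p) x < 1" using dist_triangle[of "reflect lam ?p" x y] x y by simp
    have xk: "x $ k \<le> - 3" using component_dist[of x y] x yk by (simp add: dist_commute)
    have "dist ?p (reflect lam x) < 1" using dx reflect_dist[of lam "reflect lam ?p" x] by simp
    then have u1: "c1 \<le> u (reflect lam x)" by (rule c1(2)[OF x0])
    have "G \<le> h (2 * lam - x $ k) * f (u (reflect lam x))"
      unfolding G_def using xk lam u1 c1 h_pos[of 1]
      by (intro mult_mono h_le f_le h_nonneg less_imp_le[OF f_pos]) auto
    moreover have "h (x $ k) * f (u x) \<le> 0"
      using h_nonpos[of "x $ k"] xk f_u_pos[of x] by (intro mult_nonpos_nonneg) auto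
    ultimately have "G \<le> g lam x" by (simp add: g_def)
    also have "\<dots> \<le> c * (cost_const * b * (1 / 2) powr (- 2 * s))"
      using le[of "{}" 0] by simp
    finally show "G / Q \<le> b" using Q by (simp add: Q_def pos_divide_le_eq mult_ac)
  qed
  then show ?thesis using G Q by (intro that[of "G / Q"]) auto
qed

text \<open>The mass of \<open>w lam\<close> on the mirror ball acts as the gain at a point touched
  near \<open>y\<close>. The coefficient \<open>h (x $ k)\<close> may be negative, but it multiplies
  an \<open>f\<close>-difference of at most \<open>L * b\<close>, and \<open>Q\<close> absorbs the
  resulting multiple of \<open>b\<close>.\<close>

lemma near_lower_bound:
  assumes \<delta>: "0 < \<delta>" and lam: "0 \<le> lam" "ordered lam" and d0: "0 < d0"
  obtains b1 where "0 < b1" "\<And>x0 y. 0 \<le> x0 $ k \<Longrightarrow> x0 $ k \<le> lam + 1 \<Longrightarrow> \<delta> \<le> u x0 \<Longrightarrow>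
    dist x0 y \<le> 1 \<Longrightarrow> y $ k \<le> lam - d0 \<Longrightarrow> b1 \<le> w lam y"
proof -
  obtain b0 where b0: "0 < b0" "\<And>x0 y. 0 \<le> x0 $ k \<Longrightarrow> x0 $ k \<le> lam + 1 \<Longrightarrow> \<delta> \<le> u x0 \<Longrightarrow>
    dist (reflect lam (x0 + (2 * lam + 5) *\<^sub>R axis k 1)) y < 1 / 2 \<Longrightarrow> b0 \<le> w lam y"
    using reflected_lower_bound[OF \<delta> lam] by blast
  define r where "r = min (d0 / 2) (1 / 2)"
  have r: "0 < r" "2 * r \<le> d0" "r \<le> 1 / 2" using d0 by (auto simp: r_def)
  \<comment> \<open>\<open>2 * lam + 10\<close> bounds the distance from the touching point to the
    mirror ball; \<open>16 * r\<close> is the term \<open>4 * r * 4\<close> of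
    \<open>norm_diff_refl_sq\<close>, for depths at least \<open>r\<close> and
    \<open>4\<close>.\<close>
  have "0 < 2 * lam + 10" "0 < 16 * r" using lam r by auto
  then obtain J0 where J0: "0 < J0" "\<And>x y y'. x \<noteq> y \<Longrightarrow> norm (x - y) \<le> 2 * lam + 10 \<Longrightarrow>
    (norm (x - y))\<^sup>2 + 16 * r \<le> (norm (x - y'))\<^sup>2 \<Longrightarrow> J0 \<le> K (x - y) - K (x - y')"
    by (rule kernel_gap) blast
  define I0 where "I0 = unit_vol * (1 / 2) ^ CARD('n) * b0"
  define Q where "Q = c * cost_const * r powr (- 2 * s) - h (- 2) * L"
  have I0: "0 < I0" using unit_vol_pos b0 by (simp add: I0_def)
  have h2: "h (- 2) * L \<le> 0" using h_nonpos[of "- 2"] L by (intro mult_nonpos_nonneg) auto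
  have Q: "0 < Q" using c cost_const_pos h2 r by (auto simp: Q_def intro!: add_pos_nonneg[of _ "- (h (- 2) * L)", simplified])
  have low: "- 0 \<le> w lam y" if "y $ k \<le> lam" for y
    using lam(2) that by (auto simp: ordered_def w_def)
  have "c * J0 * I0 / Q \<le> w lam y"
    if x0: "0 \<le> x0 $ k" "x0 $ k \<le> lam + 1" "\<delta> \<le> u x0"
      and y: "dist x0 y \<le> 1" "y $ k \<le> lam - d0" for x0 y
  proof (rule dense_ge)
    fix b assume b: "w lam y < b"
    define q where "q = reflect lam (x0 + (2 * lam + 5) *\<^sub>R axis k 1)"
    have qk: "q $ k = - x0 $ k - 5" by (simp add: q_def reflect_nth)
    have "q = x0 - (2 * x0 $ k + 5) *\<^sub>R axis k 1"
      by (auto simp: vec_eq_iff q_def reflect_nth axis_def)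
    then have qx: "dist x0 q = 2 * x0 $ k + 5" using x0 by (simp add: dist_norm)
    obtain x where x: "x \<in> ball y r" "r < lam - x $ k" "w lam x \<le> w lam y" and le:
      "\<And>A J0. A \<in> sets borel \<Longrightarrow> bounded A \<Longrightarrow> 0 \<le> J0 \<Longrightarrow>
      (\<And>y. y \<in> A \<Longrightarrow> y $ k < lam \<and> y \<notin> ball x r \<and> J0 \<le> K (x - y) - K (x - reflect lam y)) \<Longrightarrow>
      g lam x \<le> c * (cost_const * b * r powr (- 2 * s) - depth_const * 0 * (lam - x $ k) powr (- 2 * s)
        - J0 * (LINT y|lborel. indicator A y * (w lam y + 0)))"
      by (rule w_min[OF order_refl low, of y b r]) (use b y r in auto)
    have dx: "dist x0 x \<le> 3 / 2" using dist_triangle[of x0 x y] x y r by simp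
    have xk: "- 2 \<le> x $ k" using component_dist[of x x0] dx x0 by (simp add: dist_commute)
    have wx: "0 \<le> w lam x" "w lam x \<le> b" using low[of x] x b r by auto
    have "f (u (reflect lam x)) - f (u x) \<le> L * b"
      using f_w_lip_le[of lam x b] wx by simp
    then have "h (- 2) * (L * b) \<le> h (- 2) * (f (u (reflect lam x)) - f (u x))"
      using h_nonpos[of "- 2"] by (intro mult_left_mono_neg) auto
    also have "\<dots> \<le> h (x $ k) * (f (u (reflect lam x)) - f (u x))"
      using wx u_pos[of x] f_le[of "u x" "u (reflect lam x)"]
      by (intro mult_right_mono h_le xk) (auto simp: w_def)
    also have "\<dots> \<le> g lam x" using x r by (intro g_ge) auto
    also have "\<dots> \<le> c * (cost_const * b * r powr (- 2 * s) - depth_const * 0 * (lam - x $ k) powr (- 2 * s)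
        - J0 * (LINT y|lborel. indicator (ball q (1 / 2)) y * (w lam y + 0)))"
    proof (rule le)
      fix z assume z: "z \<in> ball q (1 / 2)"
      have zk: "z $ k \<le> - 4" using component_dist[of z q] z qk x0 by (simp add: dist_commute)
      have far: "1 \<le> dist x z" using component_dist[of x z] xk zk by simp
      have "dist x z \<le> 2 * lam + 10"
        using dist_triangle[of x z x0] dist_triangle[of x0 z q] dx z qx x0 by (simp add: dist_commute)
      moreover have "r * 4 \<le> (lam - x $ k) * (lam - z $ k)"
        using x zk lam r by (intro mult_mono) auto
      then have "(norm (x - z))\<^sup>2 + 16 * r \<le> (norm (x - reflect lam z))\<^sup>2"
        unfolding norm_diff_refl_sq mult.assoc by linarith
      ultimately have "J0 \<le> K (x - z) - K (x - reflect lam z)"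
        using far by (intro J0(2)) (auto simp: dist_norm)
      then show "z $ k < lam \<and> z \<notin> ball x r \<and> J0 \<le> K (x - z) - K (x - reflect lam z)"
        using far r zk lam by auto
    qed (use J0 in auto)
    finally have "h (- 2) * (L * b) \<le> c * (cost_const * b * r powr (- 2 * s)) -
        c * J0 * (LINT y|lborel. indicator (ball q (1 / 2)) y * w lam y)"
      by (simp add: right_diff_distrib mult_ac)
    moreover have "c * J0 * I0 \<le> c * J0 * (LINT y|lborel. indicator (ball q (1 / 2)) y * w lam y)"
      unfolding I0_def using c J0 b0(2)[OF x0]
      by (intro mult_left_mono integral_ball_ge w_integrable) (auto simp: q_def)
    ultimately have "c * J0 * I0 \<le> b * Q" by (simp add: Q_def algebra_simps)
    then show "c * J0 * I0 / Q \<le> b" using Q by (simp add: pos_divide_le_eq)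
  qed
  then show ?thesis using c J0 I0 Q by (intro that[of "c * J0 * I0 / Q"]) auto
qed

section \<open>Near-minima of the reflected difference\<close>

text \<open>With perturbation radius half the depth, the depth gain is at least
  \<open>depth_const / 9 * m * r powr (- 2 * s)\<close>, and the choice of \<open>\<eta>\<close>
  spends at most half of it. So \<open>g\<close> is negative at \<open>x\<close>; as the
  \<open>f\<close>-difference has the sign given by \<open>w < 0\<close>, this forces
  \<open>h (x $ k) > 0\<close>.\<close>

lemma near_minimum:
  assumes bad: "\<not> ordered lam" and \<eta>: "0 < \<eta>" "\<eta> \<le> 1 / 2" "cost_const * \<eta> \<le> depth_const / 18"
  obtains m x where "0 < m" "\<And>y. y $ k \<le> lam \<Longrightarrow> - m \<le> w lam y" "w lam x < - m + \<eta> * m"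
    "0 < x $ k" "x $ k < lam"
    "c * depth_const / 18 * m * (lam - x $ k) powr (- 2 * s) \<le> h (x $ k) * (f (u x) - f (u (reflect lam x)))"
proof -
  define X where "X = {y :: real ^ 'n. y $ k \<le> lam}"
  define m where "m = - Inf (w lam ` X)"
  obtain x' where x': "x' \<in> X" "w lam x' < 0"
    using bad by (auto simp: ordered_def X_def w_def not_le)
  have bdd: "bdd_below (w lam ` X)"
  proof (rule bdd_belowI2)
    show "- M \<le> w lam y" for y using w_bound[of lam y] by linarith
  qed
  have low: "- m \<le> w lam y" if "y $ k \<le> lam" for y
    unfolding m_def using that bdd by (auto simp: X_def intro: cInf_lower)
  have m: "0 < m" using low[of x'] x' by (simp add: X_def)
  have "0 < \<eta> * m" using \<eta> m by simp
  moreover have "Inf (w lam ` X) = - m" by (simp add: m_def)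
  ultimately have "Inf (w lam ` X) < - m + \<eta> * m" by linarith
  then obtain x0 where x0: "x0 \<in> X" "w lam x0 < - m + \<eta> * m"
    using cInf_lessD[of "w lam ` X"] x' by blast
  have "\<eta> * m \<le> 1 / 2 * m" using \<eta> m by (intro mult_right_mono) auto
  then have neg: "w lam x0 < 0" using x0 m by linarith
  have "x0 $ k \<noteq> lam"
  proof
    assume "x0 $ k = lam"
    then have "w lam x0 = 0" by (simp add: w_def reflect_hyperplane)
    with neg show False by simp
  qed
  then have x0k: "x0 $ k < lam" using x0 by (simp add: X_def)
  define r where "r = (lam - x0 $ k) / 2"
  have r: "0 < r" using x0k by (simp add: r_def)
  obtain x where x: "r < lam - x $ k" "lam - x $ k < lam - x0 $ k + r" "w lam x \<le> w lam x0" and le: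
    "\<And>A J0. A \<in> sets borel \<Longrightarrow> bounded A \<Longrightarrow> 0 \<le> J0 \<Longrightarrow>
      (\<And>y. y \<in> A \<Longrightarrow> y $ k < lam \<and> y \<notin> ball x r \<and> J0 \<le> K (x - y) - K (x - reflect lam y)) \<Longrightarrow>
      g lam x \<le> c * (cost_const * (\<eta> * m) * r powr (- 2 * s) - depth_const * m * (lam - x $ k) powr (- 2 * s)
        - J0 * (LINT y|lborel. indicator A y * (w lam y + m)))"
    by (rule w_min[OF less_imp_le[OF m] low x0(2) r]) (auto simp: r_def)
  let ?d = "lam - x $ k"
  have "lam - x0 $ k = 2 * r" by (simp add: r_def)
  then have dr: "?d \<le> 3 * r" using x(2) by linarith
  \<comment> \<open>The depth of \<open>x\<close> is at most \<open>3 * r\<close>, and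
    \<open>2 * s < 2\<close> gives \<open>3 powr (- 2 * s) \<ge> 1 / 9\<close>.\<close>
  have d3: "r powr (- 2 * s) / 9 \<le> ?d powr (- 2 * s)"
  proof -
    have "r powr (- 2 * s) / 9 = 3 powr (- 2) * r powr (- 2 * s)" by (simp add: powr_minus_divide)
    also have "\<dots> \<le> 3 powr (- 2 * s) * r powr (- 2 * s)"
      using s1 by (intro mult_right_mono powr_mono) auto
    also have "\<dots> = (3 * r) powr (- 2 * s)" using r by (simp add: powr_mult)
    also have "\<dots> \<le> ?d powr (- 2 * s)" using dr x r s0 by (intro powr_mono2') auto
    finally show ?thesis .
  qed
  have "g lam x \<le> c * (cost_const * (\<eta> * m) * r powr (- 2 * s) - depth_const * m * ?d powr (- 2 * s))"
    using le[of "{}" 0] by simp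
  also have "\<dots> \<le> c * (depth_const / 18 * m * r powr (- 2 * s) - depth_const * m * (r powr (- 2 * s) / 9))"
    using mult_right_mono[OF \<eta>(3), of "m * r powr (- 2 * s)"] mult_left_mono[OF d3, of "depth_const * m"] c m depth_const_pos
    by (intro mult_left_mono diff_mono) (auto simp: mult_ac)
  also have "\<dots> = - (c * depth_const / 18 * m * r powr (- 2 * s))" by (simp add: algebra_simps)
  also have "\<dots> \<le> - (c * depth_const / 18 * m * ?d powr (- 2 * s))"
  proof -
    have "?d powr (- 2 * s) \<le> r powr (- 2 * s)" using x r s0 by (intro powr_mono2') auto
    then have "c * depth_const / 18 * m * ?d powr (- 2 * s) \<le> c * depth_const / 18 * m * r powr (- 2 * s)"
      using c m depth_const_pos by (intro mult_left_mono) auto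
    then show ?thesis by simp
  qed
  finally have gx: "g lam x \<le> - (c * depth_const / 18 * m * ?d powr (- 2 * s))" .
  moreover have xk: "x $ k < lam" using x r by simp
  ultimately have final: "c * depth_const / 18 * m * ?d powr (- 2 * s) \<le> h (x $ k) * (f (u x) - f (u (reflect lam x)))"
    using g_ge[of x lam] by (simp add: algebra_simps)
  have "0 < c * depth_const / 18 * m * ?d powr (- 2 * s)" using c depth_const_pos m xk by simp
  then have pos: "0 < h (x $ k) * (f (u x) - f (u (reflect lam x)))" using final by linarith
  have "w lam x < 0" using x neg by simp
  then have "0 \<le> f (u x) - f (u (reflect lam x))"
    using f_le[of "u (reflect lam x)" "u x"] u_pos[of "reflect lam x"] by (simp add: w_def)
  then have "0 < h (x $ k)" using pos by (simp add: zero_less_mult_iff)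
  then have "0 < x $ k" using h_nonpos[of "x $ k"] by (cases "0 < x $ k") auto
  with m low x x0 xk final show ?thesis by (intro that[of m x]) auto
qed

text \<open>The starting position: a near-minimum would lie in the empty slab
  \<open>0 < x $ k < lam\<close>.\<close>

lemma ordered_nonpos:
  assumes "lam \<le> 0"
  shows "ordered lam"
proof (rule ccontr)
  assume bad: "\<not> ordered lam"
  define \<eta> where "\<eta> = min (1 / 2) (depth_const / 18 / cost_const)"
  have \<eta>: "0 < \<eta>" "\<eta> \<le> 1 / 2" using cost_const_pos depth_const_pos by (auto simp: \<eta>_def)
  have "cost_const * \<eta> \<le> cost_const * (depth_const / 18 / cost_const)" unfolding \<eta>_def using cost_const_pos by (intro mult_left_mono) auto
  then have "cost_const * \<eta> \<le> depth_const / 18" using cost_const_pos by simp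
  then obtain x where "0 < x $ k" "x $ k < lam"
    using near_minimum[OF bad \<eta>] by blast
  with assms show False by simp
qed

section \<open>Continuation in the position of the plane\<close>

lemma ordered_closed: "closed {lam. ordered lam}"
proof -
  \<comment> \<open>Points on the plane are fixed, so \<open>max\<close> absorbs the side condition
    and each \<open>x\<close> yields a condition that is closed in \<open>lam\<close>.\<close>
  have "(x $ k \<le> lam \<longrightarrow> u x \<le> u (reflect lam x)) \<longleftrightarrow> u x \<le> u (reflect (max lam (x $ k)) x)" for lam x
    by (cases "x $ k \<le> lam") (auto simp: max_def reflect_hyperplane)
  then have "{lam. ordered lam} = (\<Inter>x. {lam. u x \<le> u (reflect (max lam (x $ k)) x)})"
    by (auto simp: ordered_def)
  also have "closed \<dots>"
  proof (intro closed_INT ballI closed_Collect_le continuous_intros)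
    fix x :: "real ^ 'n"
    show "continuous_on UNIV (\<lambda>lam. u (reflect (max lam (x $ k)) x))"
      unfolding reflect_def by (intro continuous_on_compose2[OF u_cont] continuous_intros) auto
  qed
  finally show ?thesis .
qed

text \<open>Moving the plane by \<open>t / 2\<close> moves the mirror ball by \<open>t\<close>; the
  ball of radius \<open>r - t\<close> about the old centre lies in both. The loss is at most
  \<open>M\<close> times a shell volume, uniformly in \<open>z\<close>, which matters because
  near-minima have no controlled location.\<close>

lemma translated_ball_integral:
  assumes t: "0 \<le> t" "t \<le> r"
  shows "(LINT y|lborel. indicator (ball z r) y * u (reflect lam y)) - M * unit_vol * (r ^ CARD('n) - (r - t) ^ CARD('n))
    \<le> (LINT y|lborel. indicator (ball z r) y * u (reflect (lam + t / 2) y))"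
proof -
  let ?z = "reflect lam z" and ?z' = "reflect (lam + t / 2) z"
  have zz: "dist ?z ?z' = t" using t by (simp add: reflect_def dist_norm algebra_simps)
  have eq: "(LINT y|lborel. indicator (ball z r) y * u (reflect a y)) =
      (LINT y|lborel. indicator (ball (reflect a z) r) y * u y)" for a
  proof -
    have "(LINT y|lborel. indicator (ball (reflect a z) r) y * u y) =
        (LINT y|lborel. indicator (ball (reflect a z) r) (reflect a y) * u (reflect a y))"
      by (rule integral_refl[symmetric]) measurable
    also have "\<dots> = (LINT y|lborel. indicator (ball z r) y * u (reflect a y))"
      by (simp add: indicator_def reflect_dist)
    finally show ?thesis ..
  qed
  have I: "integrable lborel (\<lambda>y. indicator (ball ?z r) y * M)"
    "integrable lborel (\<lambda>y. indicator (ball ?z (r - t)) y * M)"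
    using t by (intro integrable_ball_const(1); simp)+
  have "(LINT y|lborel. indicator (ball ?z r) y * u y) \<le>
      (LINT y|lborel. indicator (ball ?z' r) y * u y +
        (indicator (ball ?z r) y * M - indicator (ball ?z (r - t)) y * M))"
  proof (rule integral_mono)
    fix y
    have "dist ?z' y < r" if "dist ?z y < r - t"
      using that dist_triangle[of ?z' y ?z] zz by (simp add: dist_commute)
    then show "indicator (ball ?z r) y * u y \<le> indicator (ball ?z' r) y * u y +
        (indicator (ball ?z r) y * M - indicator (ball ?z (r - t)) y * M)"
      using u_pos[of y] u_le[of y] t
      by (cases "dist ?z y < r - t"; cases "dist ?z y < r"; cases "dist ?z' y < r") simp_all
  qed (use I u_integrable in auto)
  also have "\<dots> = (LINT y|lborel. indicator (ball ?z' r) y * u y) +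
      ((LINT y|lborel. indicator (ball ?z r) y * M) - (LINT y|lborel. indicator (ball ?z (r - t)) y * M))"
    by (intro trans[OF Bochner_Integration.integral_add] arg_cong2[where f = "(+)"]
        Bochner_Integration.integral_diff Bochner_Integration.integrable_diff I u_integrable HOL.refl)
  also have "(LINT y|lborel. indicator (ball ?z r) y * M) = unit_vol * r ^ CARD('n) * M"
    using t by (intro integrable_ball_const(2)) auto
  also have "(LINT y|lborel. indicator (ball ?z (r - t)) y * M) = unit_vol * (r - t) ^ CARD('n) * M"
    using t by (intro integrable_ball_const(2)) auto
  finally show ?thesis unfolding eq by (simp add: algebra_simps)
qed

text \<open>All constants depend on \<open>lam\<close> only. A near-minimum of \<open>w lam'\<close>
  is deep enough, with \<open>u\<close> large enough, for \<open>near_lower_bound\<close>. The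
  positive average of \<open>w lam\<close> on a ball below it survives the passage to
  \<open>lam'\<close>, so the average of \<open>w lam' + m\<close> exceeds \<open>m\<close>, and
  this gain outweighs all other terms.\<close>

lemma ordered_open:
  assumes lam: "0 \<le> lam" "ordered lam"
  obtains \<epsilon> where "0 < \<epsilon>" "\<And>lam'. lam < lam' \<Longrightarrow> lam' < lam + \<epsilon> \<Longrightarrow> ordered lam'"
proof -
  define H where "H = h (lam + 1)"
  define \<kappa> where "\<kappa> = c * depth_const / 18"
  \<comment> \<open>The factor of \<open>r powr (- 2 * s)\<close> in \<open>J0\<close> times the
    volume of \<open>ball z r\<close>: half the kernel at distance \<open>5 * r\<close>.\<close>
  define G where "G = (1 / 2) * 5 powr (- kexp) * unit_vol"
  define \<eta> where "\<eta> = min (1 / 2) (min (depth_const / 18 / cost_const) (G / (4 * cost_const)))"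
  have H: "0 < H" using lam by (simp add: H_def h_pos)
  have \<kappa>: "0 < \<kappa>" using c depth_const_pos by (simp add: \<kappa>_def)
  have G: "0 < G" using unit_vol_pos by (simp add: G_def)
  have \<eta>: "0 < \<eta>" "\<eta> \<le> 1 / 2" "cost_const * \<eta> \<le> depth_const / 18" "cost_const * \<eta> \<le> G / 4"
  proof -
    show "0 < \<eta>" "\<eta> \<le> 1 / 2" using cost_const_pos depth_const_pos G by (auto simp: \<eta>_def)
    have "cost_const * \<eta> \<le> cost_const * (depth_const / 18 / cost_const)" "cost_const * \<eta> \<le> cost_const * (G / (4 * cost_const))"
      unfolding \<eta>_def using cost_const_pos by (intro mult_left_mono; simp)+
    then show "cost_const * \<eta> \<le> depth_const / 18" "cost_const * \<eta> \<le> G / 4" using cost_const_pos by auto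
  qed
  \<comment> \<open>Makes \<open>H * \<eta>2\<close> half of the least possible left side of
    \<open>key2\<close> per unit of \<open>m\<close>, attained at the largest depth
    \<open>lam + 1\<close>.\<close>
  define \<eta>2 where "\<eta>2 = \<kappa> * (lam + 1) powr (- 2 * s) / (2 * H)"
  have \<eta>2: "0 < \<eta>2" using \<kappa> H lam by (simp add: \<eta>2_def)
  obtain \<delta> where \<delta>: "0 < \<delta>" "\<And>a b. 0 \<le> a \<Longrightarrow> a < \<delta> \<Longrightarrow> 0 \<le> b \<Longrightarrow> b < \<delta> \<Longrightarrow> \<bar>f a - f b\<bar> \<le> \<eta>2 * \<bar>a - b\<bar>"
    using f_flat[OF \<eta>2] by blast
  \<comment> \<open>At depth less than \<open>r1\<close> the left side of \<open>key2\<close> would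
    exceed the Lipschitz bound \<open>H * L * m\<close>.\<close>
  define Q where "Q = H * L / \<kappa>"
  define r1 where "r1 = Q powr (- 1 / (2 * s))"
  have Q: "0 < Q" using H L \<kappa> by (simp add: Q_def)
  have r1: "0 < r1" using Q by (simp add: r1_def)
  \<comment> \<open>Once \<open>r powr (- 2 * s)\<close> reaches \<open>Q'\<close>, the reaction
    term \<open>H * L / c\<close> takes at most a quarter of the gain
    \<open>G * r powr (- 2 * s)\<close>.\<close>
  define Q' where "Q' = 4 * H * L / (c * G)"
  have Q': "0 < Q'" using H L c G by (simp add: Q'_def)
  define r where "r = min (r1 / 8) (min (1 / 8) (Q' powr (- 1 / (2 * s))))"
  have r: "0 < r" "8 * r \<le> r1" "r \<le> 1 / 8" "r \<le> Q' powr (- 1 / (2 * s))"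
    using r1 Q' by (auto simp: r_def)
  have "(Q' powr (- 1 / (2 * s))) powr (- 2 * s) \<le> r powr (- 2 * s)"
    using r s0 by (intro powr_mono2') auto
  then have "Q' \<le> r powr (- 2 * s)" using Q' s0 by (simp add: powr_powr)
  then have HLr: "H * L / c \<le> G / 4 * r powr (- 2 * s)"
    using c G by (simp add: Q'_def field_simps)
  have "0 < r1 / 2" using r1 by simp
  then obtain b1 where b1: "0 < b1" "\<And>x0 y. 0 \<le> x0 $ k \<Longrightarrow> x0 $ k \<le> lam + 1 \<Longrightarrow> \<delta> \<le> u x0 \<Longrightarrow>
    dist x0 y \<le> 1 \<Longrightarrow> y $ k \<le> lam - r1 / 2 \<Longrightarrow> b1 \<le> w lam y"
    using near_lower_bound[OF \<delta>(1) lam] by blast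
  have "((\<lambda>t. M * unit_vol * (r ^ CARD('n) - (r - t) ^ CARD('n))) \<longlongrightarrow>
      M * unit_vol * (r ^ CARD('n) - (r - 0) ^ CARD('n))) (at_right 0)"
    by (intro tendsto_intros)
  then have "((\<lambda>t. M * unit_vol * (r ^ CARD('n) - (r - t) ^ CARD('n))) \<longlongrightarrow> 0) (at_right 0)"
    by simp
  moreover have "0 < unit_vol * r ^ CARD('n) * b1" using unit_vol_pos r b1 by simp
  ultimately have "\<forall>\<^sub>F t in at_right 0. M * unit_vol * (r ^ CARD('n) - (r - t) ^ CARD('n)) < unit_vol * r ^ CARD('n) * b1"
    by (rule order_tendstoD)
  then obtain \<tau> where \<tau>: "0 < \<tau>" "\<And>t. 0 < t \<Longrightarrow> t < \<tau> \<Longrightarrow>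
      M * unit_vol * (r ^ CARD('n) - (r - t) ^ CARD('n)) < unit_vol * r ^ CARD('n) * b1"
    unfolding eventually_at_right[OF zero_less_one] by blast
  \<comment> \<open>The mirror ball moves by less than \<open>2 * \<epsilon>\<close>, hence by less
    than \<open>\<tau>\<close> and \<open>r\<close>; the bound \<open>r1 / 2\<close> keeps the
    relevant points deep below the old plane as well.\<close>
  define \<epsilon> where "\<epsilon> = min (min 1 (r1 / 2)) (min (\<tau> / 2) (r / 2))"
  have \<epsilon>: "0 < \<epsilon>" "\<epsilon> \<le> 1" "\<epsilon> \<le> r1 / 2" "2 * \<epsilon> \<le> \<tau>" "2 * \<epsilon> \<le> r" using r1 \<tau> r by (auto simp: \<epsilon>_def)
  have "ordered lam'" if l: "lam < lam'" "lam' < lam + \<epsilon>" for lam'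
  proof (rule ccontr)
    assume bad: "\<not> ordered lam'"
    obtain m x where m: "0 < m" and low: "\<And>y. y $ k \<le> lam' \<Longrightarrow> - m \<le> w lam' y"
      and x: "w lam' x < - m + \<eta> * m" "0 < x $ k" "x $ k < lam'"
      and key: "\<kappa> * m * (lam' - x $ k) powr (- 2 * s) \<le> h (x $ k) * (f (u x) - f (u (reflect lam' x)))"
      unfolding \<kappa>_def by (rule near_minimum[OF bad \<eta>(1-3)]) blast
    let ?d = "lam' - x $ k"
    have d: "0 < ?d" "?d \<le> lam + 1" using x l \<epsilon> by auto
    have hH: "h y \<le> H" if "y \<le> lam'" for y unfolding H_def using that l \<epsilon> by (intro h_le) auto
    have "\<eta> * m \<le> 1 / 2 * m" using \<eta> m by (intro mult_right_mono) auto
    then have neg: "w lam' x < 0" using x m by linarith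
    have wm: "\<bar>w lam' x\<bar> \<le> m" using neg low[of x] x by simp
    have fpos: "0 \<le> f (u x) - f (u (reflect lam' x))"
      using f_le[of "u (reflect lam' x)" "u x"] neg u_pos[of "reflect lam' x"] by (simp add: w_def)
    have key2: "\<kappa> * m * ?d powr (- 2 * s) \<le> H * (f (u x) - f (u (reflect lam' x)))"
      using key mult_right_mono[OF hH fpos, of "x $ k"] x by linarith
    have dr1: "r1 \<le> ?d"
    proof (rule ccontr)
      assume "\<not> r1 \<le> ?d"
      then have "r1 powr (- 2 * s) < ?d powr (- 2 * s)" using d s0 by (intro powr_less_mono2_neg) auto
      then have "Q < ?d powr (- 2 * s)" using Q s0 by (simp add: r1_def powr_powr)
      then have "H * L < \<kappa> * ?d powr (- 2 * s)" using \<kappa> by (simp add: Q_def pos_divide_less_eq mult_ac)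
      then have "H * L * m < \<kappa> * m * ?d powr (- 2 * s)" using m by (simp add: mult_ac)
      moreover have "H * (f (u x) - f (u (reflect lam' x))) \<le> H * (L * m)"
        using f_w_lip_le[OF wm] H by (intro mult_left_mono) auto
      ultimately show False using key2 by (simp add: mult_ac)
    qed
    have ux: "\<delta> \<le> u x"
    proof (rule ccontr)
      assume "\<not> \<delta> \<le> u x"
      then have "f (u x) - f (u (reflect lam' x)) \<le> \<eta>2 * \<bar>w lam' x\<bar>"
        using \<delta>(2)[of "u x" "u (reflect lam' x)"] neg u_pos[of x] u_pos[of "reflect lam' x"]
        by (auto simp: w_def abs_minus_commute)
      also have "\<dots> \<le> \<eta>2 * m" using wm \<eta>2 by (intro mult_left_mono) auto
      finally have "\<kappa> * m * ?d powr (- 2 * s) \<le> H * (\<eta>2 * m)"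
        using key2 mult_left_mono[of "f (u x) - f (u (reflect lam' x))" "\<eta>2 * m" H] H by linarith
      also have "\<dots> = \<kappa> * m * (lam + 1) powr (- 2 * s) / 2" using H by (simp add: \<eta>2_def)
      also have "\<dots> < \<kappa> * m * (lam + 1) powr (- 2 * s)" using \<kappa> m lam by simp
      also have "\<dots> \<le> \<kappa> * m * ?d powr (- 2 * s)"
        using d s0 \<kappa> m by (intro mult_left_mono powr_mono2') auto
      finally show False by simp
    qed
    have r_le: "2 * r \<le> ?d" using dr1 r by simp
    obtain x1 where x1: "x1 \<in> ball x r" "r < lam' - x1 $ k" "w lam' x1 \<le> w lam' x" and le:
      "\<And>A J0. A \<in> sets borel \<Longrightarrow> bounded A \<Longrightarrow> 0 \<le> J0 \<Longrightarrow>
      (\<And>y. y \<in> A \<Longrightarrow> y $ k < lam' \<and> y \<notin> ball x1 r \<and> J0 \<le> K (x1 - y) - K (x1 - reflect lam' y)) \<Longrightarrow>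
      g lam' x1 \<le> c * (cost_const * (\<eta> * m) * r powr (- 2 * s) - depth_const * m * (lam' - x1 $ k) powr (- 2 * s)
        - J0 * (LINT y|lborel. indicator A y * (w lam' y + m)))"
      by (rule w_min[OF less_imp_le[OF m] low x(1) r(1) r_le]) auto
    have x1k: "\<bar>x $ k - x1 $ k\<bar> < r" using component_dist[of x x1] x1 by simp
    \<comment> \<open>\<open>ball z r\<close> avoids \<open>ball x1 r\<close> and stays within
      \<open>5 * r\<close> of \<open>x1\<close>, while its mirror points are at least
      \<open>10 * r\<close> away. Doubling the distance at least halves the kernel, since
      \<open>kexp \<ge> 1\<close>.\<close>
    define z where "z = x - (3 * r) *\<^sub>R axis k 1"
    have zk: "z $ k = x $ k - 3 * r" by (simp add: z_def)
    have xz: "dist x z = 3 * r" using r by (simp add: z_def dist_norm)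
    define J0 where "J0 = 1 / 2 * (5 * r) powr (- kexp)"
    have J0: "0 < J0" using r by (simp add: J0_def)
    let ?I = "\<lambda>lam. LINT y|lborel. indicator (ball z r) y * w lam y"
    have gle: "g lam' x1 \<le> c * (cost_const * (\<eta> * m) * r powr (- 2 * s) - depth_const * m * (lam' - x1 $ k) powr (- 2 * s)
        - J0 * (LINT y|lborel. indicator (ball z r) y * (w lam' y + m)))"
    proof (rule le)
      fix y assume y: "y \<in> ball z r"
      have yk: "\<bar>z $ k - y $ k\<bar> < r" using component_dist[of z y] y by simp
      have yl: "y $ k < lam'" using yk zk x r by linarith
      have far: "r < dist x1 y" using component_dist[of x1 y] yk zk x1k by linarith
      have near: "dist x1 y \<le> 5 * r"
        using dist_triangle[of x1 y x] dist_triangle[of x y z] x1 y xz by (simp add: dist_commute)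
      have "10 * r \<le> (lam' - x1 $ k) + (lam' - y $ k)"
        using x1k yk zk dr1 r by linarith
      also have "\<dots> \<le> norm (x1 - reflect lam' y)"
        using component_le_norm_cart[of "x1 - reflect lam' y" k] by (simp add: reflect_nth)
      finally have "K (x1 - reflect lam' y) \<le> (10 * r) powr (- kexp)" using r by (intro K_le) auto
      also have "\<dots> = 2 powr (- kexp) * (5 * r) powr (- kexp)"
        using r by (simp flip: powr_mult)
      also have "\<dots> \<le> 1 / 2 * (5 * r) powr (- kexp)"
      proof (rule mult_right_mono)
        have "2 powr (- kexp) \<le> 2 powr (- 1)" using kexp_ge1 by (intro powr_mono) auto
        then show "2 powr (- kexp) \<le> 1 / 2" by (simp add: powr_minus_divide)
      qed simp
      finally have "K (x1 - reflect lam' y) \<le> 1 / 2 * (5 * r) powr (- kexp)" .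
      moreover have "(5 * r) powr (- kexp) \<le> K (x1 - y)"
        using near far r by (intro K_ge) (auto simp: dist_norm)
      ultimately show "y $ k < lam' \<and> y \<notin> ball x1 r \<and> J0 \<le> K (x1 - y) - K (x1 - reflect lam' y)"
        using yl far by (auto simp: J0_def)
    qed (use J0 in auto)
    have "unit_vol * r ^ CARD('n) * b1 \<le> ?I lam"
    proof (intro integral_ball_ge w_integrable b1(2)[of x] ux)
      fix y assume y: "y \<in> ball z r"
      have yk: "\<bar>z $ k - y $ k\<bar> < r" using component_dist[of z y] y by simp
      show "dist x y \<le> 1" using dist_triangle[of x y z] y xz r by simp
      show "y $ k \<le> lam - r1 / 2" using yk zk dr1 l \<epsilon> r by linarith
    qed (use x r l \<epsilon> in auto)
    also have "?I lam \<le> ?I lam' + M * unit_vol * (r ^ CARD('n) - (r - 2 * (lam' - lam)) ^ CARD('n))"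
    proof -
      have i: "integrable lborel (\<lambda>y. indicator (ball z r) y * u (reflect a y))" for a
      proof (rule integrable_indicator_bounded)
        show "\<bar>u (reflect a y)\<bar> \<le> M" for y using u_pos[of "reflect a y"] u_le[of "reflect a y"] by simp
      qed auto
      have split: "?I a = (LINT y|lborel. indicator (ball z r) y * u (reflect a y)) -
          (LINT y|lborel. indicator (ball z r) y * u y)" for a
        unfolding w_def right_diff_distrib using i u_integrable by simp
      have "lam + 2 * (lam' - lam) / 2 = lam'" by (simp add: field_simps)
      then show ?thesis
        using translated_ball_integral[of "2 * (lam' - lam)" r z lam] l \<epsilon> r unfolding split by simp
    qed
    also have "M * unit_vol * (r ^ CARD('n) - (r - 2 * (lam' - lam)) ^ CARD('n)) < unit_vol * r ^ CARD('n) * b1"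
      using l \<epsilon> by (intro \<tau>(2)) auto
    finally have I: "0 < ?I lam'" by simp
    have "(LINT y|lborel. indicator (ball z r) y * (w lam' y + m)) = ?I lam' + unit_vol * r ^ CARD('n) * m"
      using w_integrable[of z r lam'] integrable_ball_const[of r z m] r by (simp add: distrib_left)
    then have "J0 * (unit_vol * r ^ CARD('n) * m) \<le> J0 * (LINT y|lborel. indicator (ball z r) y * (w lam' y + m))"
      using I J0 by simp
    moreover have "J0 * (unit_vol * r ^ CARD('n) * m) = G * r powr (- 2 * s) * m"
      using card_powr[OF r(1)] r by (simp add: J0_def G_def powr_mult mult_ac)
    moreover have "0 \<le> depth_const * m * (lam' - x1 $ k) powr (- 2 * s)" using depth_const_pos m by simp
    ultimately have "c * (cost_const * (\<eta> * m) * r powr (- 2 * s) - depth_const * m * (lam' - x1 $ k) powr (- 2 * s)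
        - J0 * (LINT y|lborel. indicator (ball z r) y * (w lam' y + m))) \<le>
        c * (cost_const * (\<eta> * m) * r powr (- 2 * s) - G * r powr (- 2 * s) * m)"
      using c by (intro mult_left_mono) auto
    also have "\<dots> = c * ((cost_const * \<eta> - G) * (r powr (- 2 * s) * m))"
      by (simp add: algebra_simps)
    \<comment> \<open>The perturbation cost uses a quarter of the gain. Three quarters remain
      against a reaction term that \<open>HLr\<close> limits to one quarter.\<close>
    also have "\<dots> \<le> c * ((- (3 / 4) * G) * (r powr (- 2 * s) * m))"
      using c \<eta>(4) m by (intro mult_left_mono mult_right_mono) auto
    finally have gle': "g lam' x1 \<le> c * ((- (3 / 4) * G) * (r powr (- 2 * s) * m))"
      using gle by linarith
    have neg1: "w lam' x1 < 0" using x1 neg by simp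
    have f1: "f (u (reflect lam' x1)) - f (u x1) \<le> 0"
      using f_le[of "u (reflect lam' x1)" "u x1"] neg1 u_pos[of "reflect lam' x1"] by (simp add: w_def)
    have x1l: "x1 $ k \<le> lam'" using x1 r by simp
    have wm1: "\<bar>w lam' x1\<bar> \<le> m" using neg1 low[OF x1l] by simp
    have "H * (- (L * m)) \<le> H * (f (u (reflect lam' x1)) - f (u x1))"
      using f_w_lip_le[OF wm1] H by (intro mult_left_mono) auto
    also have "\<dots> \<le> h (x1 $ k) * (f (u (reflect lam' x1)) - f (u x1))"
      by (rule mult_right_mono_neg[OF hH[OF x1l] f1])
    also have "\<dots> \<le> g lam' x1" by (rule g_ge[OF x1l])
    also note gle'
    finally have "c * (3 / 4 * G * r powr (- 2 * s) * m) \<le> c * (H * L / c * m)"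
      using c by (simp add: mult_ac)
    then have "3 / 4 * G * r powr (- 2 * s) * m \<le> H * L / c * m"
      using c by (rule mult_left_le_imp_le)
    also have "\<dots> \<le> G / 4 * r powr (- 2 * s) * m" using HLr m by (intro mult_right_mono) auto
    finally have "3 / 4 * G * r powr (- 2 * s) * m \<le> G / 4 * r powr (- 2 * s) * m" .
    moreover have "0 < G * r powr (- 2 * s) * m" using G m r by simp
    ultimately show False by linarith
  qed
  with \<epsilon>(1) show ?thesis by (rule that)
qed

text \<open>The ordered positions in \<open>[0, lam]\<close> form a nonempty closed set, and
  \<open>ordered_open\<close> produces a larger one if its supremum is below
  \<open>lam\<close>.\<close>

lemma ordered_all: "ordered lam"
proof (rule ccontr)
  assume bad: "\<not> ordered lam"
  then have lam: "0 < lam" using ordered_nonpos[of lam] by linarith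
  define X where "X = {t. 0 \<le> t \<and> t \<le> lam \<and> ordered t}"
  define t where "t = Sup X"
  have ne: "0 \<in> X" using lam ordered_nonpos by (simp add: X_def)
  have bdd: "bdd_above X" by (rule bdd_aboveI[of _ lam]) (simp add: X_def)
  have "X = {0..lam} \<inter> {t. ordered t}" by (auto simp: X_def)
  then have "closed X" using ordered_closed by (simp add: closed_Int)
  then have "t \<in> X" unfolding t_def using ne bdd by (intro closed_contains_Sup) auto
  then have t: "0 \<le> t" "t \<le> lam" "ordered t" by (auto simp: X_def)
  then have tl: "t < lam" using bad by (cases "t = lam") auto
  obtain \<epsilon> where \<epsilon>: "0 < \<epsilon>" "\<And>lam'. t < lam' \<Longrightarrow> lam' < t + \<epsilon> \<Longrightarrow> ordered lam'"
    using ordered_open[OF t(1,3)] by blast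
  define t' where "t' = min lam (t + \<epsilon> / 2)"
  have t': "t < t'" "t' \<le> lam" "t' < t + \<epsilon>" using tl \<epsilon>(1) by (auto simp: t'_def)
  then have "t' \<in> X" using \<epsilon>(2) t by (simp add: X_def)
  then have "t' \<le> t" unfolding t_def using bdd by (rule cSup_upper)
  with t' show False by simp
qed

section \<open>Monotonicity and the final contradiction\<close>

text \<open>Translation of \<open>x\<close> by \<open>t\<close> is reflection of \<open>x\<close> in
  the plane at height \<open>x $ k + t / 2\<close>.\<close>

lemma u_mono: "0 \<le> t \<Longrightarrow> u x \<le> u (x + t *\<^sub>R axis k 1)"
  using ordered_all[of "x $ k + t / 2"] by (auto simp: ordered_def reflect_def dest!: spec[of _ x])

text \<open>Monotonicity carries the minimum of \<open>u\<close> over the unit ball to all its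
  upward translates. Touching with \<open>b = M + 1\<close> bounds
  \<open>h (x $ k) * f (u x)\<close> independently of the height, although \<open>h\<close> is
  unbounded.\<close>

lemma no_bounded_solution: False
proof -
  obtain z where z: "z \<in> cball 0 1" and min: "\<And>y. y \<in> cball 0 1 \<Longrightarrow> u z \<le> u y"
    using continuous_attains_inf[of "cball 0 1" u] u_cont
    by (meson compact_cball cball_eq_empty continuous_on_subset not_one_less_zero subset_UNIV)
  \<comment> \<open>Any value of \<open>h\<close> above \<open>B\<close> contradicts the touching
    estimate at a point where \<open>u \<ge> u z\<close>.\<close>
  define B where "B = c * ((M + 1) * (core_const + tail_const)) / f (u z)"
  have "\<forall>\<^sub>F t in at_top. B < h t" using h_top by (simp add: filterlim_at_top_dense)
  then obtain t0 where t0: "\<And>t. t0 \<le> t \<Longrightarrow> B < h t" by (auto simp: eventually_at_top_linorder)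
  define t where "t = max 0 t0"
  let ?p = "(t + 1) *\<^sub>R axis k 1 :: real ^ 'n"
  have b: "u ?p < M + 1" using u_le[of ?p] by simp
  obtain x where x: "x \<in> ball ?p 1" and le:
      "\<And>z \<rho> J0. 0 \<le> J0 \<Longrightarrow> (\<And>y. y \<in> ball z \<rho> \<Longrightarrow> y \<notin> ball x 1 \<and> J0 \<le> K (x - y)) \<Longrightarrow>
      h (x $ k) * f (u x) \<le> c * ((M + 1) * (core_const + tail_const) * 1 powr (- 2 * s) -
        J0 * (LINT y|lborel. indicator (ball z \<rho>) y * u y))"
    by (rule supersolution_touch[OF b, of 1]) auto
  have "t \<le> x $ k" using component_dist[of ?p x] x by simp
  then have hx: "B < h (x $ k)" using t0 by (simp add: t_def)
  have "x - ?p \<in> cball 0 1" using x by (simp add: dist_norm norm_minus_commute)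
  then have "u z \<le> u (x - ?p)" by (rule min)
  also have "\<dots> \<le> u ((x - ?p) + (t + 1) *\<^sub>R axis k 1)" by (rule u_mono) (simp add: t_def)
  finally have uz: "u z \<le> u x" by simp
  have B0: "0 \<le> B" using c M_pos core_const_nonneg tail_const_nonneg f_u_pos[of z] by (simp add: B_def)
  have "c * ((M + 1) * (core_const + tail_const)) = B * f (u z)" using f_u_pos[of z] by (simp add: B_def)
  also have "\<dots> < h (x $ k) * f (u z)" using hx f_u_pos by (intro mult_strict_right_mono)
  also have "\<dots> \<le> h (x $ k) * f (u x)"
    using hx B0 uz f_le[of "u z" "u x"] u_pos[of z] by (intro mult_left_mono) auto
  also have "\<dots> \<le> c * ((M + 1) * (core_const + tail_const))" using le[of 0 0 0] by simp
  finally show False by simp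
qed

end

section \<open>Regularity of the data\<close>

lemma locally_C_holder_continuous:
  assumes "locally_C_holder j \<theta> u" "0 < \<theta>"
  shows "continuous_on UNIV u"
proof (cases j)
  case 0
  then have hol: "locally_holder_on UNIV \<theta> u" using assms by simp
  show ?thesis unfolding continuous_on_eq_continuous_at[OF open_UNIV]
  proof
    fix x
    obtain r C where r: "0 < r" and C: "\<And>y z. y \<in> cball x r \<Longrightarrow> z \<in> cball x r \<Longrightarrow>
        dist (u y) (u z) \<le> C * dist y z powr \<theta>"
      using hol unfolding locally_holder_on_def by (metis Int_UNIV_right UNIV_I)
    have "((\<lambda>y. dist y x powr \<theta>) \<longlongrightarrow> dist x x powr \<theta>) (at x)"
      using assms(2) by (intro tendsto_powr2 tendsto_intros) auto
    then have "((\<lambda>y. C * dist y x powr \<theta>) \<longlongrightarrow> C * dist x x powr \<theta>) (at x)"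
      by (rule tendsto_mult_left)
    then have lim: "((\<lambda>y. C * dist y x powr \<theta>) \<longlongrightarrow> 0) (at x)"
      by simp
    have "dist (u y) (u x) \<le> dist (C * dist y x powr \<theta>) 0" if "dist y x < r" for y
      using C[of y x] that r by (simp add: dist_commute)
    then have "\<forall>\<^sub>F y in at x. dist (u y) (u x) \<le> dist (C * dist y x powr \<theta>) 0"
      unfolding eventually_at using r by blast
    then show "isCont u x" unfolding isCont_def by (rule metric_tendsto_imp_tendsto[OF lim])
  qed
next
  case (Suc i)
  then show ?thesis using assms by (simp add: differentiable_imp_continuous_on)
qed

text \<open>Compactness of \<open>{0..M}\<close>; the time-dependent notion
  \<open>local_lipschitz\<close> is used with the one-point time set \<open>{0}\<close>.\<close>

lemma locally_lipschitz_imp_lipschitz: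
  fixes f :: "real \<Rightarrow> real"
  assumes "locally_lipschitz_on {0..} f"
  obtains L where "L-lipschitz_on {0..M} f"
proof -
  have "local_lipschitz {0::real} {0..M} (\<lambda>_. f)"
  proof (rule local_lipschitzI)
    fix t :: real and x assume "x \<in> {0..M}"
    then have "x \<in> {0..}" by simp
    then obtain r C where r: "0 < r" "C-lipschitz_on (cball x r \<inter> {0..}) f"
      using assms unfolding locally_lipschitz_on_def by blast
    have "C-lipschitz_on (cball x r \<inter> {0..M}) f"
      by (rule lipschitz_on_subset[OF r(2)]) auto
    with r(1) show "\<exists>u>0. \<exists>L. \<forall>t\<in>cball t u \<inter> {0}. L-lipschitz_on (cball x u \<inter> {0..M}) f"
      by blast
  qed
  then show ?thesis
    by (rule local_lipschitz_compact_implies_lipschitz) (use that in auto)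
qed

text \<open>The index \<open>k\<close> singles out the last coordinate, the cardinality of
  \<open>'n\<close> is the dimension, and \<open>c\<close> is the normalization constant.\<close>

theorem theorem1:
  fixes c s \<alpha> :: real
    and h f :: "real \<Rightarrow> real"
    and k :: "'n::finite"
  assumes "0 < c"
    and "0 < s" and "s < 1"
    and "0 < \<alpha>" and "\<alpha> < 1" and "locally_holder_on UNIV \<alpha> h"
    and "mono h" and "h 0 = 0" and "\<And>t. 0 < t \<Longrightarrow> 0 < h t"
    and "filterlim h at_top at_top"
    and "locally_lipschitz_on {0..} f" and "mono_on {0..} f"
    and "f 0 = 0" and "\<And>t. 0 < t \<Longrightarrow> 0 < f t"
    and "((\<lambda>(r, t). (f r - f t) / (r - t)) \<longlongrightarrow> 0)
           (at (0, 0) within {(r, t). 0 \<le> r \<and> 0 \<le> t \<and> r \<noteq> t})"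
  shows "\<not> (\<exists>u :: real ^ 'n \<Rightarrow> real.
            (\<forall>x. 0 < u x) \<and> bounded (range u) \<and>
            classical_solution c s (\<lambda>x v. h (x $ k) * f v) u)"
proof (intro notI, elim exE conjE)
  fix u :: "real ^ 'n \<Rightarrow> real"
  assume pos: "\<forall>x. 0 < u x" and bdd: "bounded (range u)"
    and sol: "classical_solution c s (\<lambda>x v. h (x $ k) * f v) u"
  obtain j \<theta> where "0 < \<theta>" "locally_C_holder j \<theta> u"
    using sol unfolding classical_solution_def locally_C_def by blast
  then have cont: "continuous_on UNIV u" by (rule_tac locally_C_holder_continuous)
  obtain M where M: "\<And>x. u x \<le> M"
    using bdd unfolding bounded_iff by (metis abs_le_D1 rangeI real_norm_def)
  obtain L where L: "L-lipschitz_on {0..M} f"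
    using locally_lipschitz_imp_lipschitz[OF assms(11)] .
  have flat: "\<exists>\<delta>>0. \<forall>a b. 0 \<le> a \<and> a < \<delta> \<and> 0 \<le> b \<and> b < \<delta> \<longrightarrow> \<bar>f a - f b\<bar> \<le> \<eta> * \<bar>a - b\<bar>"
    if \<eta>: "0 < \<eta>" for \<eta>
  proof -
    obtain d where d: "0 < d" and quot: "\<And>p. p \<in> {(r, t). 0 \<le> r \<and> 0 \<le> t \<and> r \<noteq> t} \<Longrightarrow>
        p \<noteq> (0, 0) \<Longrightarrow> dist p (0, 0) < d \<Longrightarrow>
        dist (case p of (r, t) \<Rightarrow> (f r - f t) / (r - t)) 0 < \<eta>"
      using tendstoD[OF assms(15) \<eta>] unfolding eventually_at by blast
    \<comment> \<open>Halving \<open>d\<close> puts the pair \<open>(a, b)\<close> within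
      \<open>d\<close> of the origin, since its norm is at most \<open>a + b\<close>. The diagonal,
      outside the limit, is trivial.\<close>
    have "\<bar>f a - f b\<bar> \<le> \<eta> * \<bar>a - b\<bar>" if ab: "0 \<le> a" "a < d / 2" "0 \<le> b" "b < d / 2" for a b
    proof (cases "a = b")
      case False
      have "dist (a, b) (0, 0) \<le> \<bar>a\<bar> + \<bar>b\<bar>"
        using sqrt_sum_squares_le_sum_abs[of a b] by (simp add: dist_norm norm_Pair)
      also have "\<dots> < d" using ab by simp
      finally have "\<bar>f a - f b\<bar> / \<bar>a - b\<bar> < \<eta>" using quot[of "(a, b)"] ab False by auto
      then show ?thesis using False by (simp add: pos_divide_less_eq)
    qed simp
    then show ?thesis using d by (intro exI[of _ "d / 2"]) auto
  qed
  \<comment> \<open>A Lipschitz constant may be \<open>0\<close>, whereas the locale asks for a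
    positive one; hence \<open>L + 1\<close>.\<close>
  interpret bounded_solution s k c M "L + 1" h f u
  proof
    show "\<bar>f a - f b\<bar> \<le> (L + 1) * \<bar>a - b\<bar>" if "0 \<le> a" "a \<le> M" "0 \<le> b" "b \<le> M" for a b
      using lipschitz_onD[OF L, of a b] that by (auto simp: dist_real_def distrib_right)
    show "0 < L + 1" using lipschitz_on_nonneg[OF L] by simp
    show "has_frac_laplacian c s u x (h (x $ k) * f (u x))" for x
      using sol unfolding classical_solution_def by blast
  qed (use assms pos M cont flat in auto)
  show False by (rule no_bounded_solution)
qed

end
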